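(* Let $\mathbb{X},\mathbb{Y}$ be polygonal Banach spaces such that $\dim(\mathbb{X})=\dim(\mathbb{Y})=2$. Let $T\in\mathbb{L}(\mathbb{X},\mathbb{Y})$ with $\|T\|=1$. Then $T$ is an extreme contraction if and only if one of the following holds: (i) $M_T\cap Ext(B_{\mathbb{X}})=\{\pm x_1,\pm x_2\}$ and $Tx_1,Tx_2\in Ext(B_{\mathbb{Y}})$. (ii) $M_T\cap Ext(B_{\mathbb{X}})=\{\pm x_1,\pm x_2,\pm x_3\}$ and $|\{x_i: Tx_i\in Ext(B_{\mathbb{Y}}),\,1\leq i\leq 3\}|\geq 2$. (iii) $M_T\cap Ext(B_{\mathbb{X}})=\{\pm x_1,\pm x_2,\pm x_3\}$, $Tx_1\in Ext(B_{\mathbb{Y}})$, $Tx_2,Tx_3\notin Ext(B_{\mathbb{Y}})$, and there exist edges $F,G$ of $B_{\mathbb{Y}}$ such that $Tx_2\in F$, $Tx_3\in G$ and $F\neq\pm G$. (iv) $|M_T\cap Ext(B_{\mathbb{X}})|\geq 8$ and there exists $x\in M_T\cap Ext(B_{\mathbb{X}})$ such that $Tx\in Ext(B_{\mathbb{Y}})$. (v) $|M_T\cap Ext(B_{\mathbb{X}})|\geq 8$ and for each $x\in M_T\cap Ext(B_{\mathbb{X}})$, $Tx\notin Ext(B_{\mathbb{Y}})$. Moreover, there exist $x_i\in M_T\cap Ext(B_{\mathbb{X}})$ and $y_i^*\in Ext\,J(Tx_i)$ for $1\leq i\leq 4$ such that $x_2=ax_1+bx_3$, $x_4=cx_1+dx_3$,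 $y_2^*=\alpha_1y_1^*+\alpha_2y_3^*$, $y_4^*=\beta_1y_1^*+\beta_2y_3^*$ and $\beta_1\alpha_2ad-\beta_2\alpha_1bc\neq 0$ (here $a,b,c,d,\alpha_1,\alpha_2,\beta_1,\beta_2$ are real scalars).
   Context: All Banach spaces are real. $\mathbb{L}(\mathbb{X},\mathbb{Y})$ is the space of bounded linear operators from $\mathbb{X}$ to $\mathbb{Y}$ with the operator norm. $B_{\mathbb{X}}$ and $S_{\mathbb{X}}$ are the closed unit ball and the unit sphere of $\mathbb{X}$, $\mathbb{X}^*$ is the dual space of $\mathbb{X}$, $Ext(A)$ is the set of extreme points of a convex set $A$, and $|A|$ is the cardinality of a set $A$. A two-dimensional Banach space is polygonal if its unit ball has only finitely many extreme points (so the unit ball is a polygon); an edge of the ball is a $1$-dimensional face of this polygon. $M_T=\{x\in S_{\mathbb{X}}:\|Tx\|=\|T\|\}$. For $y\in S_{\mathbb{Y}}$, $J(y)=\{y^*\in S_{\mathbb{Y}^*}:y^*(y)=1\}$, and $Ext\,J(y)$ is the set of extreme points of this convex set. An operator $T$ is an extreme contraction if it is an extreme point of the closed unit ball of $\mathbb{L}(\mathbb{X},\mathbb{Y})$.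
   Formalization: The points ±x_i listed in (i)–(iii) are required to be distinct, and in (v) the points x_1,…,x_4 are required to be pairwise distinct; without this (v) holds trivially with all x_i equal and the equivalence fails (e.g. octagon vertices mapped to edge midpoints of a larger octagon). *)

theory Defs
  imports "HOL-Analysis.Analysis"
begin

definition Ext :: "'a::real_vector set \<Rightarrow> 'a set" where
  "Ext A = {x. x extreme_point_of A}"

text \<open>A nonzero value of \<^const>\<open>dim\<close> is the genuine dimension; \<^const>\<open>dim\<close> is 0 on
  infinite-dimensional spaces.\<close>

definition polygonal :: "'a::real_normed_vector itself \<Rightarrow> bool" where
  "polygonal _ \<longleftrightarrow> dim (UNIV :: 'a set) = 2 \<and> finite (Ext (cball (0::'a) 1))"

text \<open>The library's \<^const>\<open>edge_of\<close> is available only for Euclidean spaces, because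
  \<^const>\<open>aff_dim\<close> is. The affine dimension of a nonempty set is the dimension of the span of its
  differences.\<close>

definition edges :: "'a::real_vector set \<Rightarrow> 'a set set" where
  "edges A = {F. F face_of A \<and> dim {x - y | x y. x \<in> F \<and> y \<in> F} = 1}"

definition norm_attain :: "('a::real_normed_vector \<Rightarrow>\<^sub>L 'b::real_normed_vector) \<Rightarrow> 'a set" where
  "norm_attain T = {x \<in> sphere 0 1. norm (blinfun_apply T x) = norm T}"

definition supp_functionals :: "'b::real_normed_vector \<Rightarrow> ('b \<Rightarrow>\<^sub>L real) set" where
  "supp_functionals y = {f \<in> sphere 0 1. blinfun_apply f y = 1}"

definition extreme_contraction :: "('a::real_normed_vector \<Rightarrow>\<^sub>L 'b::real_normed_vector) \<Rightarrow> bool" where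
  "extreme_contraction T \<longleftrightarrow> T \<in> Ext (cball 0 1)"

end

theory Submission
  imports Defs
begin

text \<open>Since the unit ball of the domain is the convex hull of its finitely many extreme points,
  \<open>T\<close> fails to be extreme iff some \<open>S \<noteq> 0\<close> satisfies the following linear conditions, one for each
  \<open>x \<in> M\<^sub>T \<inter> Ext B\<^sub>X\<close>: \<open>S x = 0\<close> if \<open>T x\<close> is extreme, and otherwise \<open>f (S x) = 0\<close>, where \<open>f\<close> is the only
  supporting functional at \<open>T x\<close>. Up to the sign of \<open>x\<close> these are two, respectively one, equations
  on the four-dimensional space of operators. They are counted using that
  \<open>{x. f (T x) = 1}\<close> is a line and so contains at most two extreme points: with at least four pairs
  \<open>\<plusminus>x\<close>, at most two of them share the functional \<open>f\<close> up to sign.\<close>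

section \<open>Normed planes\<close>

text \<open>The conditions on \<open>S\<close> are linear because a non-extreme image can move both
  ways along its edge while a vertex cannot move at all. The determinant in (v) comes from the
  equations that are left over: if \<open>y1 (S x1) = 0\<close> and \<open>y3 (S x3) = 0\<close>
  with \<open>y1\<close>, \<open>y3\<close> independent, then \<open>S\<close> is determined by the
  two numbers \<open>y3 (S x1)\<close> and \<open>y1 (S x3)\<close>, and the conditions at
  \<open>x2\<close> and \<open>x4\<close> are two homogeneous equations in them. In one direction
  these four equations already force \<open>S = 0\<close>. In the other, a nonzero \<open>S\<close>
  is built that satisfies three of them, and extremality then supplies the fourth point. The
  obstacle is that the wording of (v) leaves room for \<open>y1\<close> and \<open>y3\<close> to
  agree up to sign, where the coefficients of \<open>y2\<close> and \<open>y4\<close> are not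
  unique; there the bound on extreme points of a line does the work instead.\<close>

definition noncollinear :: "'a::real_vector \<Rightarrow> 'a \<Rightarrow> bool" where
  "noncollinear u v \<longleftrightarrow> (\<forall>a b. a *\<^sub>R u + b *\<^sub>R v = 0 \<longrightarrow> a = 0 \<and> b = 0)"

text \<open>The inequality matters on its own: for \<open>u = v\<close> the set
  \<open>{u, v}\<close> collapses to a singleton, which can be independent although the pair is
  not.\<close>

lemma noncollinear_independent:
  assumes "noncollinear u v"
  shows "u \<noteq> v" "independent {u, v}"
proof -
  show uv: "u \<noteq> v"
  proof
    assume "u = v"
    then have "1 *\<^sub>R u + (-1) *\<^sub>R v = 0"
      by simp
    then have "(1::real) = 0"
      using assms unfolding noncollinear_def by blast
    then show False
      by simp
  qed
  have "v \<noteq> 0"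
  proof
    assume "v = 0"
    then have "0 *\<^sub>R u + 1 *\<^sub>R v = 0"
      by simp
    then have "(1::real) = 0"
      using assms unfolding noncollinear_def by blast
    then show False
      by simp
  qed
  moreover have "u \<notin> span {v}"
  proof
    assume "u \<in> span {v}"
    then obtain c where "u = c *\<^sub>R v"
      by (auto simp: span_singleton)
    then have "1 *\<^sub>R u + (-c) *\<^sub>R v = 0"
      by simp
    then have "(1::real) = 0"
      using assms unfolding noncollinear_def by blast
    then show False
      by simp
  qed
  ultimately show "independent {u, v}"
    using uv by (simp add: independent_insert)
qed

lemma noncollinear_sym: "noncollinear u v \<Longrightarrow> noncollinear v u"
  unfolding noncollinear_def by (metis add.commute)

lemma noncollinear_not_scaleR:
  assumes "noncollinear u v"
  shows "u \<noteq> c *\<^sub>R v"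
proof
  assume "u = c *\<^sub>R v"
  then have "1 *\<^sub>R u + (- c) *\<^sub>R v = 0"
    by simp
  then have "(1::real) = 0"
    using assms unfolding noncollinear_def by blast
  then show False
    by simp
qed

lemma noncollinearI:
  assumes "v \<noteq> 0" and "\<And>c. u \<noteq> c *\<^sub>R v"
  shows "noncollinear u v"
  unfolding noncollinear_def
proof (intro allI impI)
  fix a b
  assume 0: "a *\<^sub>R u + b *\<^sub>R v = 0"
  have "a = 0"
  proof (rule ccontr)
    assume a: "a \<noteq> 0"
    from 0 have "a *\<^sub>R u = (-b) *\<^sub>R v"
      by (simp add: eq_neg_iff_add_eq_0)
    then have "(1/a) *\<^sub>R a *\<^sub>R u = (1/a) *\<^sub>R (-b) *\<^sub>R v"
      by simp
    then have "u = (- b / a) *\<^sub>R v"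
      using a by simp
    then show False
      using assms(2) by blast
  qed
  with 0 show "a = 0 \<and> b = 0"
    using assms(1) by simp
qed

lemma noncollinear_unit:
  fixes x y :: "'a::real_normed_vector"
  assumes "norm x = 1" "norm y = 1" "x \<noteq> y" "x \<noteq> - y"
  shows "noncollinear x y"
proof (rule noncollinearI)
  show "y \<noteq> 0"
    using assms(2) by auto
  show "x \<noteq> c *\<^sub>R y" for c
  proof
    assume *: "x = c *\<^sub>R y"
    with assms have "\<bar>c\<bar> = 1"
      by simp
    then have "c = 1 \<or> c = -1"
      by linarith
    with * assms show False
      by auto
  qed
qed

lemma noncollinear_functional:
  fixes f :: "'a::real_normed_vector \<Rightarrow>\<^sub>L real"
  assumes "f y \<noteq> 0" "f w = 0" "w \<noteq> 0"
  shows "noncollinear y w"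
  by (rule noncollinearI) (use assms in \<open>auto simp: blinfun.scaleR_right\<close>)

text \<open>A vector outside the span would give three independent vectors, against the exchange
  bound from a basis of two elements.\<close>

lemma noncollinear_coordinates:
  fixes u v z :: "'a::real_vector"
  assumes dim: "dim (UNIV :: 'a set) = 2" and "noncollinear u v"
  obtains a b where "z = a *\<^sub>R u + b *\<^sub>R v"
proof -
  note uv = noncollinear_independent[OF assms(2)]
  have "z \<in> span {u, v}"
  proof (rule ccontr)
    assume z: "z \<notin> span {u, v}"
    then have ind: "independent {z, u, v}"
      using uv by (simp add: independent_insert)
    obtain B :: "'a set" where B: "independent B" "span B = UNIV"
      using maximal_independent_subset[of "UNIV :: 'a set"] by (metis top.extremum_unique)
    then have "card B = 2"
      using dim dim_eq_card[of B "UNIV :: 'a set"] by simp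
    then have "card {z, u, v} \<le> 2"
      using independent_span_bound[OF card_ge_0_finite ind, of B] B by simp
    moreover have "z \<noteq> u" "z \<noteq> v"
      using z by (auto simp: span_base)
    ultimately show False
      using uv by simp
  qed
  then obtain a where "z - a *\<^sub>R u \<in> span {v}"
    by (auto simp: span_insert)
  then obtain b where "z - a *\<^sub>R u = b *\<^sub>R v"
    by (auto simp: span_singleton)
  then show thesis
    using that[of a b] by (simp add: diff_eq_eq add.commute)
qed

lemma ex_noncollinear:
  assumes dim: "dim (UNIV :: 'a::real_vector set) = 2" and "(u::'a) \<noteq> 0"
  obtains v where "noncollinear u v"
proof -
  have "\<exists>v. v \<notin> span {u}"
  proof (rule ccontr)
    assume "\<not> ?thesis"
    then have "dim (UNIV :: 'a set) \<le> card {u}"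
      by (intro dim_le_card) auto
    with dim show False
      by simp
  qed
  then obtain v where "v \<notin> span {u}" ..
  then have "noncollinear v u"
    using assms(2) by (intro noncollinearI) (auto simp: span_singleton)
  then show thesis
    using noncollinear_sym that by blast
qed

lemma ex_nonzero:
  assumes dim: "dim (UNIV :: 'a::real_vector set) = 2"
  shows "\<exists>u::'a. u \<noteq> 0"
proof (rule ccontr)
  assume "\<not> ?thesis"
  then have "dim (UNIV :: 'a set) \<le> card ({} :: 'a set)"
    by (intro dim_le_card) auto
  with dim show False
    by simp
qed

section \<open>Transfer between a normed plane and the Euclidean plane\<close>

definition plane_map :: "'a::real_vector \<Rightarrow> 'a \<Rightarrow> real \<times> real \<Rightarrow> 'a" where
  "plane_map u v p = fst p *\<^sub>R u + snd p *\<^sub>R v"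

lemma bounded_linear_plane_map:
  fixes u v :: "'a::real_normed_vector"
  shows "bounded_linear (plane_map u v)"
  unfolding plane_map_def by (intro bounded_linear_intros)

lemma linear_plane_map: "linear (plane_map u v)"
  by (rule linearI) (auto simp: plane_map_def algebra_simps)

lemma inj_plane_map:
  assumes "noncollinear u v"
  shows "inj (plane_map u v)"
  unfolding linear_injective_0[OF linear_plane_map]
  using assms by (auto simp: plane_map_def noncollinear_def zero_prod_def)

text \<open>The norm of the image attains a minimum on the compact unit circle; injectivity makes it
  positive and homogeneity spreads the bound. It makes the inverse map and the preimage of the unit
  ball bounded.\<close>

lemma plane_map_lower_bound:
  fixes u v :: "'a::real_normed_vector"
  assumes "noncollinear u v"
  obtains m where "m > 0" "\<And>p. m * norm p \<le> norm (plane_map u v p)"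
proof -
  let ?L = "plane_map u v"
  interpret L: bounded_linear ?L
    by (rule bounded_linear_plane_map)
  have "continuous_on (sphere 0 1) (\<lambda>p. norm (?L p))"
    by (intro continuous_on_norm L.continuous_on continuous_on_id)
  moreover have "(1, 0) \<in> sphere (0 :: real \<times> real) 1"
    by simp
  ultimately obtain p0 where p0: "p0 \<in> sphere 0 1"
    "\<And>p. p \<in> sphere 0 1 \<Longrightarrow> norm (?L p0) \<le> norm (?L p)"
    using continuous_attains_inf[of "sphere (0 :: real \<times> real) 1" "\<lambda>p. norm (?L p)"]
    by (metis compact_sphere empty_iff)
  show thesis
  proof
    have "p0 \<noteq> 0"
      using p0(1) by auto
    then have "?L p0 \<noteq> 0"
      using inj_plane_map[OF assms] linear_injective_0[OF linear_plane_map] by blast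
    then show "norm (?L p0) > 0"
      by simp
    show "norm (?L p0) * norm p \<le> norm (?L p)" for p
    proof (cases "p = 0")
      case False
      have "norm (?L p0) \<le> norm (?L ((1 / norm p) *\<^sub>R p))"
        using False by (intro p0) simp
      also have "\<dots> = norm (?L p) / norm p"
        by (simp add: L.scaleR)
      finally show ?thesis
        using False by (simp add: pos_le_divide_eq)
    qed simp
  qed
qed

text \<open>Invert the coordinate map of \<open>u\<close>, \<open>v\<close> and follow it by the one
  of \<open>p\<close>, \<open>q\<close>, which need not be injective. Every explicit perturbation
  \<open>S\<close> below, and the supporting functional at a non-extreme point, arises in this
  way.\<close>

lemma plane_extension:
  fixes u v :: "'a::real_normed_vector" and p q :: "'b::real_normed_vector"
  assumes dim: "dim (UNIV :: 'a set) = 2" and uv: "noncollinear u v"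
  obtains S :: "'a \<Rightarrow>\<^sub>L 'b" where "S u = p" "S v = q"
proof -
  obtain m where m: "m > 0" "\<And>z. m * norm z \<le> norm (plane_map u v z)"
    using plane_map_lower_bound[OF uv] by blast
  define g where "g = inv (plane_map u v)"
  have inj: "inj (plane_map u v)"
    using uv by (rule inj_plane_map)
  have surj: "surj (plane_map u v)"
    unfolding surj_def
  proof
    fix z
    obtain a b where "z = a *\<^sub>R u + b *\<^sub>R v"
      using noncollinear_coordinates[OF dim uv] by blast
    then have "z = plane_map u v (a, b)"
      by (simp add: plane_map_def)
    then show "\<exists>p. z = plane_map u v p" ..
  qed
  have Lg: "plane_map u v (g z) = z" for z
    unfolding g_def using surj by (rule surj_f_inv_f)
  have bl_g: "bounded_linear g"
  proof (rule bounded_linear_intro[where K = "1 / m"])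
    show "g (x + y) = g x + g y" for x y
      by (rule injD[OF inj]) (simp add: Lg linear_add[OF linear_plane_map])
    show "g (r *\<^sub>R x) = r *\<^sub>R g x" for x r
      by (rule injD[OF inj]) (simp add: Lg linear_scale[OF linear_plane_map])
    show "norm (g x) \<le> norm x * (1 / m)" for x
      using m(2)[of "g x"] m(1) by (simp add: Lg field_simps)
  qed
  have gu: "g u = (1, 0)" and gv: "g v = (0, 1)"
    unfolding g_def using inj by (auto intro!: inv_f_eq simp: plane_map_def)
  have "bounded_linear (plane_map p q \<circ> g)"
    unfolding comp_def by (rule bounded_linear_compose[OF bounded_linear_plane_map bl_g])
  then show thesis
    by (intro that[of "Blinfun (plane_map p q \<circ> g)"])
       (auto simp: bounded_linear_Blinfun_apply gu gv plane_map_def)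
qed

lemma plane_blinfun_eq_0:
  fixes S :: "'a::real_normed_vector \<Rightarrow>\<^sub>L 'b::real_normed_vector"
  assumes dim: "dim (UNIV :: 'a set) = 2" and uv: "noncollinear u v" and "S u = 0" "S v = 0"
  shows "S = 0"
proof (rule blinfun_eqI)
  fix z
  obtain a b where "z = a *\<^sub>R u + b *\<^sub>R v"
    using noncollinear_coordinates[OF dim uv] by blast
  then show "S z = blinfun_apply 0 z"
    using assms by (simp add: blinfun.add_right blinfun.scaleR_right)
qed

text \<open>Pulled back along the coordinate map, the unit ball is a compact convex set in
  \<open>real \<times> real\<close>, where the Krein-Milman theorem applies. The linear bijection
  carries segments to segments, hence extreme points to extreme points.\<close>

lemma plane_cball_convex_hull:
  assumes dim: "dim (UNIV :: 'a::real_normed_vector set) = 2"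
  shows "cball 0 1 \<subseteq> convex hull (Ext (cball (0::'a::real_normed_vector) 1))"
proof -
  obtain u :: 'a where "u \<noteq> 0"
    using ex_nonzero[OF dim] by blast
  then obtain v where uv: "noncollinear u v"
    using ex_noncollinear[OF dim] by blast
  let ?L = "plane_map u v"
  let ?K = "?L -` cball 0 1"
  interpret L: bounded_linear ?L
    by (rule bounded_linear_plane_map)
  obtain m where m: "m > 0" "\<And>z. m * norm z \<le> norm (?L z)"
    using plane_map_lower_bound[OF uv] by blast
  have "compact ?K"
    unfolding compact_eq_bounded_closed
  proof
    show "bounded ?K"
      unfolding bounded_iff
    proof (intro exI ballI)
      fix z
      assume "z \<in> ?K"
      then have "m * norm z \<le> 1"
        using m(2)[of z] by simp
      then show "norm z \<le> 1 / m"
        using m(1) by (simp add: field_simps)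
    qed
    show "closed ?K"
      using continuous_on_closed_vimage[of UNIV ?L] L.continuous_on[OF continuous_on_id]
      by (simp add: closed_vimage)
  qed
  moreover have "convex ?K"
    by (intro convex_linear_vimage linear_plane_map convex_cball)
  ultimately have K: "?K = convex hull {z. z extreme_point_of ?K}"
    by (rule Krein_Milman_Minkowski)
  have ext: "?L ` {z. z extreme_point_of ?K} \<subseteq> Ext (cball 0 1)"
  proof clarify
    fix z
    assume z: "z extreme_point_of ?K"
    show "?L z \<in> Ext (cball 0 1)"
      unfolding Ext_def extreme_point_of_def mem_Collect_eq
    proof (intro conjI ballI)
      show "?L z \<in> cball 0 1"
        using z by (simp add: extreme_point_of_def)
      fix a b :: 'a
      assume ab: "a \<in> cball 0 1" "b \<in> cball 0 1"
      obtain p q where pq: "a = ?L p" "b = ?L q"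
        using noncollinear_coordinates[OF dim uv]
        by (metis fst_conv plane_map_def snd_conv)
      have "z \<notin> open_segment p q"
        using z ab pq by (simp add: extreme_point_of_def)
      then show "?L z \<notin> open_segment a b"
        unfolding pq open_segment_linear_image[OF linear_plane_map inj_plane_map[OF uv]]
        using inj_plane_map[OF uv] by (simp add: inj_image_mem_iff)
    qed
  qed
  show ?thesis
  proof
    fix x :: 'a
    assume x: "x \<in> cball 0 1"
    obtain a b where "x = a *\<^sub>R u + b *\<^sub>R v"
      using noncollinear_coordinates[OF dim uv] by blast
    then have "x = ?L (a, b)"
      by (simp add: plane_map_def)
    with x have "x \<in> ?L ` ?K"
      by auto
    also have "\<dots> = convex hull (?L ` {z. z extreme_point_of ?K})"
      by (subst K) (rule convex_hull_linear_image[OF linear_plane_map])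
    also have "\<dots> \<subseteq> convex hull (Ext (cball 0 1))"
      using ext by (rule hull_mono)
    finally show "x \<in> convex hull (Ext (cball 0 1))" .
  qed
qed

section \<open>Extreme points and supporting functionals\<close>

lemma Ext_subset: "Ext A \<subseteq> A"
  by (auto simp: Ext_def extreme_point_of_def)

lemma Ext_singleton: "Ext {x} = {x}"
  by (auto simp: Ext_def extreme_point_of_def)

text \<open>Symmetric perturbations replace segments. In this form extremality of an operator can be
  compared with extremality of its values, so it is applied to vectors and to operators
  alike.\<close>

lemma mem_Ext_cball_iff:
  fixes x :: "'a::real_normed_vector"
  shows "x \<in> Ext (cball 0 1) \<longleftrightarrow>
    norm x \<le> 1 \<and> (\<forall>w. norm (x + w) \<le> 1 \<and> norm (x - w) \<le> 1 \<longrightarrow> w = 0)"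
    (is "?L \<longleftrightarrow> ?R")
proof
  assume L: ?L
  then have x: "norm x \<le> 1" "\<And>a b. norm a \<le> 1 \<Longrightarrow> norm b \<le> 1 \<Longrightarrow> x \<notin> open_segment a b"
    by (auto simp: Ext_def extreme_point_of_def)
  show ?R
  proof (intro conjI allI impI)
    fix w
    assume w: "norm (x + w) \<le> 1 \<and> norm (x - w) \<le> 1"
    show "w = 0"
    proof (rule ccontr)
      assume "w \<noteq> 0"
      have "x - w \<noteq> x + w"
      proof
        assume "x - w = x + w"
        then have "2 *\<^sub>R w = 0"
          by (simp add: scaleR_2 algebra_simps)
        with \<open>w \<noteq> 0\<close> show False
          by simp
      qed
      moreover have "x = (1 - 1/2) *\<^sub>R (x - w) + (1/2) *\<^sub>R (x + w)"
        by (simp add: algebra_simps flip: scaleR_add_left)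
      ultimately have "x \<in> open_segment (x - w) (x + w)"
        unfolding in_segment by (metis half_gt_zero less_numeral_extra(1) field_sum_of_halves less_add_same_cancel1)
      with x w show False
        by blast
    qed
  qed (use x in simp)
next
  assume R: ?R
  show ?L
    unfolding Ext_def extreme_point_of_def mem_Collect_eq
  proof (intro conjI ballI)
    fix a b :: 'a
    assume ab: "a \<in> cball 0 1" "b \<in> cball 0 1"
    show "x \<notin> open_segment a b"
    proof
      assume "x \<in> open_segment a b"
      then obtain u where u: "a \<noteq> b" "0 < u" "u < 1" "x = (1 - u) *\<^sub>R a + u *\<^sub>R b"
        by (auto simp: in_segment)
      \<comment> \<open>The distance from \<open>u\<close> to the nearer end of the unit interval,
        so that the parameters \<open>u - e\<close> and \<open>u + e\<close> both stay inside
        it.\<close>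
      define e where "e = min u (1 - u)"
      have e: "0 < e" "e \<le> u" "e \<le> 1 - u"
        using u by (auto simp: e_def)
      have "x + e *\<^sub>R (b - a) = (1 - (u + e)) *\<^sub>R a + (u + e) *\<^sub>R b"
        and "x - e *\<^sub>R (b - a) = (1 - (u - e)) *\<^sub>R a + (u - e) *\<^sub>R b"
        by (simp_all add: u(4) algebra_simps)
      moreover have "(1 - s) *\<^sub>R a + s *\<^sub>R b \<in> cball 0 1" if "0 \<le> s" "s \<le> 1" for s
        using ab that by (intro convexD[OF convex_cball]) auto
      ultimately have "norm (x + e *\<^sub>R (b - a)) \<le> 1 \<and> norm (x - e *\<^sub>R (b - a)) \<le> 1"
        using e u by simp
      then show False
        using R e u(1) by (metis eq_iff_diff_eq_0 less_irrefl scaleR_eq_0_iff)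
    qed
  qed (use R in simp)
qed

lemma uminus_mem_Ext_cball_iff [simp]:
  fixes x :: "'a::real_normed_vector"
  shows "- x \<in> Ext (cball 0 1) \<longleftrightarrow> x \<in> Ext (cball 0 1)"
proof -
  have "norm (- x + w) = norm (x - w)" "norm (- x - w) = norm (x + w)" for w
    by (metis minus_diff_eq norm_minus_cancel uminus_add_conv_diff,
        metis minus_add_distrib norm_minus_cancel uminus_add_conv_diff diff_conv_add_uminus)
  then show ?thesis
    unfolding mem_Ext_cball_iff by auto
qed

text \<open>The point is the convex combination of \<open>y + w\<close> and \<open>y - w\<close>
  with weights \<open>(1 + s) / 2\<close> and \<open>(1 - s) / 2\<close>.\<close>

lemma norm_le_1_between:
  fixes y w :: "'a::real_normed_vector"
  assumes "norm (y + w) \<le> 1" "norm (y - w) \<le> 1" "\<bar>s\<bar> \<le> 1"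
  shows "norm (y + s *\<^sub>R w) \<le> 1"
proof -
  have "((1 + s) / 2) *\<^sub>R (y + w) + ((1 - s) / 2) *\<^sub>R (y - w) \<in> cball 0 1"
    using assms by (intro convexD[OF convex_cball]) (auto simp: field_simps)
  also have "((1 + s) / 2) *\<^sub>R (y + w) + ((1 - s) / 2) *\<^sub>R (y - w)
    = ((1 + s) / 2 + (1 - s) / 2) *\<^sub>R y + ((1 + s) / 2 - (1 - s) / 2) *\<^sub>R w"
    by (simp add: algebra_simps)
  also have "\<dots> = y + s *\<^sub>R w"
    by (simp flip: add_divide_distrib diff_divide_distrib)
  finally show ?thesis
    by simp
qed

text \<open>\<open>y\<close> is a convex combination of \<open>y + t *\<^sub>R w\<close> and
  \<open>y - w\<close>; if the former were in the open ball, \<open>y\<close> would have norm below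
  1.\<close>

lemma norm_ge_1_beyond:
  fixes y w :: "'a::real_normed_vector"
  assumes "norm y = 1" "norm (y - w) \<le> 1" "0 \<le> t"
  shows "1 \<le> norm (y + t *\<^sub>R w)"
proof -
  have "(1 + t) *\<^sub>R y = (y + t *\<^sub>R w) + t *\<^sub>R (y - w)"
    by (simp add: algebra_simps)
  then have "norm ((1 + t) *\<^sub>R y) \<le> norm (y + t *\<^sub>R w) + norm (t *\<^sub>R (y - w))"
    by (metis norm_triangle_ineq)
  also have "norm (t *\<^sub>R (y - w)) \<le> t"
    using assms by (simp add: mult_left_le)
  finally show ?thesis
    using assms by simp
qed

lemma mem_supp_functionals_iff:
  "f \<in> supp_functionals y \<longleftrightarrow> norm f = 1 \<and> f y = 1"
  by (simp add: supp_functionals_def)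

lemma supp_functionals_le:
  assumes "f \<in> supp_functionals y"
  shows "\<bar>f z\<bar> \<le> norm z"
  using norm_blinfun[of f z] assms by (simp add: mem_supp_functionals_iff)

text \<open>The value \<open>f y = 1\<close> is the maximum of \<open>f\<close> on the ball, so
  \<open>f\<close> can increase neither along \<open>w\<close> nor along \<open>- w\<close>.\<close>

lemma supp_functionals_eq_0:
  assumes f: "f \<in> supp_functionals y" and "norm (y + w) \<le> 1" "norm (y - w) \<le> 1"
  shows "f w = 0"
proof -
  have "f y = 1"
    using f by (simp add: mem_supp_functionals_iff)
  moreover have "\<bar>f y + f w\<bar> \<le> 1" "\<bar>f y - f w\<bar> \<le> 1"
    using supp_functionals_le[OF f, of "y + w"] supp_functionals_le[OF f, of "y - w"] assms(2,3)
    by (auto simp: blinfun.add_right blinfun.diff_right)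
  ultimately show ?thesis
    by linarith
qed

text \<open>If \<open>y\<close> is the midpoint of two points \<open>y + w\<close> and
  \<open>y - w\<close> of the ball, the line through them avoids the open ball, so the functional
  with value 1 at \<open>y\<close> and 0 at \<open>w\<close> has norm 1. Any other supporting
  functional also vanishes at \<open>w\<close> and therefore coincides with it.\<close>

lemma nonextreme_supp_functionals:
  fixes y :: "'b::real_normed_vector"
  assumes dim: "dim (UNIV :: 'b set) = 2" and y: "norm y = 1" "y \<notin> Ext (cball 0 1)"
  obtains f w where "supp_functionals y = {f}" "w \<noteq> 0" "f w = 0"
    "norm (y + w) \<le> 1" "norm (y - w) \<le> 1"
proof -
  obtain w where w: "w \<noteq> 0" "norm (y + w) \<le> 1" "norm (y - w) \<le> 1"
    using y mem_Ext_cball_iff[of y] by auto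
  have nc: "noncollinear y w"
  proof (rule noncollinearI[OF w(1)])
    fix c
    \<comment> \<open>If \<open>y = c *\<^sub>R w\<close>, the bounds on \<open>y + w\<close> and
      \<open>y - w\<close> say that neither c + 1 nor c - 1 exceeds c in absolute value, which is
      impossible.\<close>
    show "y \<noteq> c *\<^sub>R w"
    proof
      assume c: "y = c *\<^sub>R w"
      then have "y + w = (c + 1) *\<^sub>R w" "y - w = (c - 1) *\<^sub>R w"
        by (simp_all add: algebra_simps)
      with w have "\<bar>c + 1\<bar> * norm w \<le> 1" "\<bar>c - 1\<bar> * norm w \<le> 1"
        by (metis norm_scaleR)+
      moreover have "\<bar>c\<bar> * norm w = 1"
        using y c by simp
      ultimately have "\<bar>c + 1\<bar> * norm w \<le> \<bar>c\<bar> * norm w" "\<bar>c - 1\<bar> * norm w \<le> \<bar>c\<bar> * norm w"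
        by simp_all
      then have "\<bar>c + 1\<bar> \<le> \<bar>c\<bar>" "\<bar>c - 1\<bar> \<le> \<bar>c\<bar>"
        using w(1) by (meson mult_right_le_imp_le zero_less_norm_iff)+
      then show False
        by linarith
    qed
  qed
  then obtain f :: "'b \<Rightarrow>\<^sub>L real" where f: "f y = 1" "f w = 0"
    using plane_extension[OF dim, of y w 1 0] by blast
  have ge: "1 \<le> norm (y + t *\<^sub>R w)" for t
    using norm_ge_1_beyond[of y w t] norm_ge_1_beyond[of y "- w" "- t"] y(1) w
    by (cases "0 \<le> t") auto
  have bound: "\<bar>f z\<bar> \<le> norm z" for z
  proof -
    obtain a b where z: "z = a *\<^sub>R y + b *\<^sub>R w"
      using noncollinear_coordinates[OF dim nc] by blast
    have fz: "f z = a"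
      by (simp add: z f blinfun.add_right blinfun.scaleR_right)
    show ?thesis
    proof (cases "a = 0")
      case False
      then have "z = a *\<^sub>R (y + (b / a) *\<^sub>R w)"
        by (simp add: z algebra_simps)
      then have "norm z = \<bar>a\<bar> * norm (y + (b / a) *\<^sub>R w)"
        by simp
      then show ?thesis
        using ge[of "b / a"] by (simp add: fz mult_le_cancel_left1)
    qed (simp add: fz)
  qed
  have "norm f \<le> 1"
    using bound by (intro norm_blinfun_bound) auto
  moreover have "1 \<le> norm f"
    using norm_blinfun[of f y] y f by simp
  ultimately have mem: "f \<in> supp_functionals y"
    using f by (simp add: mem_supp_functionals_iff)
  have uniq: "g = f" if g: "g \<in> supp_functionals y" for g
  proof -
    have "g w = 0"
      using g w by (intro supp_functionals_eq_0)
    with g f have "g - f = 0"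
      by (intro plane_blinfun_eq_0[OF dim nc])
         (auto simp: mem_supp_functionals_iff blinfun.diff_left)
    then show ?thesis
      by simp
  qed
  have "supp_functionals y = {f}"
    using mem uniq by blast
  then show thesis
    using w f by (intro that)
qed

section \<open>Pairs of functionals on a plane\<close>

lemma ex_kernel:
  fixes f :: "'b::real_normed_vector \<Rightarrow>\<^sub>L real"
  assumes dim: "dim (UNIV :: 'b set) = 2"
  obtains w where "w \<noteq> 0" "f w = 0"
proof -
  obtain u :: 'b where "u \<noteq> 0"
    using ex_nonzero[OF dim] by blast
  then obtain v where uv: "noncollinear u v"
    using ex_noncollinear[OF dim] by blast
  show thesis
  proof (cases "f u = 0")
    case True
    then show thesis
      using that \<open>u \<noteq> 0\<close> by blast
  next
    case False
    have "f v *\<^sub>R u + (- f u) *\<^sub>R v \<noteq> 0"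
      using uv False unfolding noncollinear_def by (metis neg_equal_0_iff_equal)
    then show thesis
      by (intro that[of "f v *\<^sub>R u + (- f u) *\<^sub>R v"])
        (auto simp: blinfun.diff_right blinfun.scaleR_right)
  qed
qed

text \<open>Functionals on a plane that vanish at a common nonzero vector are proportional, and norm
  1 makes them equal up to sign.\<close>

lemma common_kernel_trivial:
  fixes f g :: "'b::real_normed_vector \<Rightarrow>\<^sub>L real"
  assumes dim: "dim (UNIV :: 'b set) = 2"
    and fg: "norm f = 1" "norm g = 1" "f \<noteq> g" "f \<noteq> - g" and w: "f w = 0" "g w = 0"
  shows "w = 0"
proof (rule ccontr)
  assume w0: "w \<noteq> 0"
  have "f \<noteq> 0"
    using fg(1) by auto
  then obtain y where y: "f y \<noteq> 0"
    by (metis blinfun_eqI zero_blinfun.rep_eq)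
  have "g - (g y / f y) *\<^sub>R f = 0"
    using y w by (intro plane_blinfun_eq_0[OF dim noncollinear_functional[OF y w(1) w0]])
      (auto simp: blinfun.diff_left blinfun.scaleR_left)
  then show False
    using noncollinear_not_scaleR[OF noncollinear_sym[OF noncollinear_unit[OF fg]]] by simp
qed

text \<open>\<open>u\<close> and \<open>v\<close> span the kernels of \<open>g\<close> and
  \<open>f\<close>, scaled to the value 1 of the other functional. The expansion of \<open>h\<close>
  later produces the scalars \<alpha> and \<beta> of (v).\<close>

lemma plane_dual_basis:
  fixes f g :: "'b::real_normed_vector \<Rightarrow>\<^sub>L real"
  assumes dim: "dim (UNIV :: 'b set) = 2"
    and fg: "norm f = 1" "norm g = 1" "f \<noteq> g" "f \<noteq> - g"
  shows "\<exists>u v. f u = 1 \<and> g u = 0 \<and> f v = 0 \<and> g v = 1 \<and>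
    (\<forall>h. h = blinfun_apply h u *\<^sub>R f + blinfun_apply h v *\<^sub>R g)"
proof -
  obtain u0 where u0: "u0 \<noteq> 0" "g u0 = 0"
    using ex_kernel[OF dim] by blast
  obtain v0 where v0: "v0 \<noteq> 0" "f v0 = 0"
    using ex_kernel[OF dim] by blast
  define u where "u = (1 / f u0) *\<^sub>R u0"
  define v where "v = (1 / g v0) *\<^sub>R v0"
  have "f u0 \<noteq> 0" "g v0 \<noteq> 0"
    using common_kernel_trivial[OF dim fg] u0 v0 by blast+
  then have uv: "f u = 1" "g u = 0" "f v = 0" "g v = 1"
    using u0 v0 by (auto simp: u_def v_def blinfun.scaleR_right)
  moreover have "h = h u *\<^sub>R f + h v *\<^sub>R g" for h :: "'b \<Rightarrow>\<^sub>L real"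
  proof -
    have nc: "noncollinear u v"
      using uv by (intro noncollinear_functional[of f]) auto
    have "h - (h u *\<^sub>R f + h v *\<^sub>R g) = 0"
      using uv by (intro plane_blinfun_eq_0[OF dim nc])
        (auto simp: blinfun.diff_left blinfun.add_left blinfun.scaleR_left)
    then show ?thesis
      by simp
  qed
  ultimately show ?thesis
    by blast
qed

section \<open>Extreme points on a line, and norms tested at extreme points\<close>

lemma Ext_three_collinear:
  fixes g :: "'a::real_normed_vector \<Rightarrow>\<^sub>L real"
  assumes dim: "dim (UNIV :: 'a set) = 2"
    and ext: "p \<in> Ext A" "q \<in> Ext A" "r \<in> Ext A" and g: "g p = 1" "g q = 1" "g r = 1"
  shows "p = q \<or> p = r \<or> q = r"
proof (rule ccontr)
  assume neq: "\<not> ?thesis"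
  have nc: "noncollinear p (q - p)"
    using g neq by (intro noncollinear_functional[of g]) (auto simp: blinfun.diff_right)
  obtain a b where ab: "r = a *\<^sub>R p + b *\<^sub>R (q - p)"
    using noncollinear_coordinates[OF dim nc] by blast
  have "a = 1"
    using g ab by (simp add: blinfun.add_right blinfun.diff_right blinfun.scaleR_right)
  then have r: "r = (1 - b) *\<^sub>R p + b *\<^sub>R q"
    using ab by (simp add: algebra_simps)
  have "b \<noteq> 0" "b \<noteq> 1"
    using neq r by auto
  \<comment> \<open>The three ranges decide which point lies strictly between the other two:
    \<open>p\<close>, \<open>r\<close> and \<open>q\<close> respectively.\<close>
  then consider "b < 0" | "0 < b" "b < 1" | "1 < b"
    by linarith
  then show False
  proof cases
    case 1
    then have "0 < - b / (1 - b)" "- b / (1 - b) < 1"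
      by (auto simp: field_simps)
    moreover have "p = (1 - - b / (1 - b)) *\<^sub>R r + (- b / (1 - b)) *\<^sub>R q"
    proof -
      have "1 - - b / (1 - b) = 1 / (1 - b)"
        using 1 by (simp add: field_simps)
      then show ?thesis
        using 1 by (simp add: r scaleR_add_right flip: scaleR_add_left)
    qed
    ultimately have "p \<in> open_segment r q"
      using neq unfolding in_segment by blast
    with ext show ?thesis
      by (auto simp: Ext_def extreme_point_of_def)
  next
    case 2
    then have "r \<in> open_segment p q"
      using neq r unfolding in_segment by blast
    with ext show ?thesis
      by (auto simp: Ext_def extreme_point_of_def)
  next
    case 3
    then have "0 < 1 / b" "1 / b < 1"
      by (auto simp: field_simps)
    moreover have "q = (1 - 1 / b) *\<^sub>R p + (1 / b) *\<^sub>R r"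
      using 3 by (simp add: r scaleR_add_right diff_divide_distrib flip: scaleR_add_left)
    ultimately have "q \<in> open_segment p r"
      using neq unfolding in_segment by blast
    with ext show ?thesis
      by (auto simp: Ext_def extreme_point_of_def)
  qed
qed

lemma card_Ext_line_le:
  fixes g :: "'a::real_normed_vector \<Rightarrow>\<^sub>L real"
  assumes dim: "dim (UNIV :: 'a set) = 2"
  shows "card {x \<in> Ext A. g x = 1} \<le> 2"
proof (rule ccontr)
  assume "\<not> ?thesis"
  then have "3 \<le> card {x \<in> Ext A. g x = 1}"
    by simp
  then obtain B where "B \<subseteq> {x \<in> Ext A. g x = 1}" "card B = 3"
    by (meson obtain_subset_with_card_n)
  then obtain p q r where "{p, q, r} \<subseteq> {x \<in> Ext A. g x = 1}" "p \<noteq> q" "p \<noteq> r" "q \<noteq> r"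
    by (auto simp: card_3_iff)
  then show False
    using Ext_three_collinear[OF dim, of p A q r g] by auto
qed

lemma card_Ext_lines_le:
  fixes g :: "'a::real_normed_vector \<Rightarrow>\<^sub>L real"
  assumes dim: "dim (UNIV :: 'a set) = 2"
  shows "card {x \<in> Ext A. \<bar>g x\<bar> = 1} \<le> 4"
proof -
  have "{x \<in> Ext A. \<bar>g x\<bar> = 1} = {x \<in> Ext A. g x = 1} \<union> {x \<in> Ext A. (- g) x = 1}"
    by (auto simp: blinfun.minus_left)
  then have "card {x \<in> Ext A. \<bar>g x\<bar> = 1}
      \<le> card {x \<in> Ext A. g x = 1} + card {x \<in> Ext A. (- g) x = 1}"
    by (metis (lifting) card_Un_le)
  then show ?thesis
    using card_Ext_line_le[OF dim, of A g] card_Ext_line_le[OF dim, of A "- g"] by linarith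
qed

text \<open>The preimage of the unit ball under \<open>S\<close> is convex, so with the extreme
  points it contains their hull, which covers the ball.\<close>

lemma plane_norm_le_1:
  fixes S :: "'a::real_normed_vector \<Rightarrow>\<^sub>L 'b::real_normed_vector"
  assumes dim: "dim (UNIV :: 'a set) = 2"
    and "\<And>x. x \<in> Ext (cball 0 1) \<Longrightarrow> norm (S x) \<le> 1"
  shows "norm S \<le> 1"
proof (rule norm_blinfun_bound)
  have "convex (S -` cball 0 1)"
    by (intro convex_linear_vimage convex_cball blinfun.bounded_linear_right bounded_linear.linear)
  then have "convex hull (Ext (cball 0 1)) \<subseteq> S -` cball 0 1"
    using assms(2) by (intro hull_minimal) auto
  then have ball: "norm (S x) \<le> 1" if "norm x \<le> 1" for x
    using plane_cball_convex_hull[OF dim] that by (metis in_mono mem_cball_0 vimage_eq)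
  show "norm (S x) \<le> 1 * norm x" for x
  proof (cases "x = 0")
    case False
    have "norm (S ((1 / norm x) *\<^sub>R x)) \<le> 1"
      using False by (intro ball) simp
    then show ?thesis
      using False by (simp add: blinfun.scaleR_right field_simps)
  qed (simp add: blinfun.zero_right)
qed simp

section \<open>Extremality of an operator as a linear problem\<close>

definition admissible :: "('a::real_normed_vector \<Rightarrow>\<^sub>L 'b::real_normed_vector) \<Rightarrow> ('a \<Rightarrow>\<^sub>L 'b) \<Rightarrow> bool"
  where "admissible T S \<longleftrightarrow> (\<forall>x \<in> norm_attain T \<inter> Ext (cball 0 1).
    if T x \<in> Ext (cball 0 1) then S x = 0 else \<forall>f \<in> supp_functionals (T x). f (S x) = 0)"

lemma extreme_contraction_iff:
  "extreme_contraction T \<longleftrightarrow>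
    norm T \<le> 1 \<and> (\<forall>S. norm (T + S) \<le> 1 \<and> norm (T - S) \<le> 1 \<longrightarrow> S = 0)"
  unfolding extreme_contraction_def by (rule mem_Ext_cball_iff)

text \<open>An image of norm below 1 has room by continuity, an extreme image is not moved, and a
  non-extreme one moves in the kernel of its functional, which is the direction of its edge. The
  eventual form allows the bounds for several \<open>x\<close> to be intersected.\<close>

lemma admissible_perturbation:
  fixes T S :: "'a::real_normed_vector \<Rightarrow>\<^sub>L 'b::real_normed_vector"
  assumes dim: "dim (UNIV :: 'b set) = 2"
    and T: "norm T = 1" and S: "admissible T S" and x: "x \<in> Ext (cball 0 1)"
  shows "\<forall>\<^sub>F e in at_right 0. norm (T x + e *\<^sub>R S x) \<le> 1 \<and> norm (T x - e *\<^sub>R S x) \<le> 1"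
proof -
  have "norm x \<le> 1"
    using x by (simp add: mem_Ext_cball_iff)
  then have Tx: "norm (T x) \<le> norm x"
    using norm_blinfun[of T x] T by simp
  show ?thesis
  proof (cases "norm (T x) < 1")
    case True
    have "((\<lambda>e. norm (T x + e *\<^sub>R S x)) \<longlongrightarrow> norm (T x + 0 *\<^sub>R S x)) (at_right 0)"
      "((\<lambda>e. norm (T x - e *\<^sub>R S x)) \<longlongrightarrow> norm (T x - 0 *\<^sub>R S x)) (at_right 0)"
      by (intro tendsto_intros)+
    then have "\<forall>\<^sub>F e in at_right 0. norm (T x + e *\<^sub>R S x) < 1"
      "\<forall>\<^sub>F e in at_right 0. norm (T x - e *\<^sub>R S x) < 1"
      using True by (auto intro: order_tendstoD(2))
    then show ?thesis
      by eventually_elim simp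
  next
    case False
    with Tx \<open>norm x \<le> 1\<close> have nx: "norm x = 1" "norm (T x) = 1"
      by linarith+
    then have ME: "x \<in> norm_attain T \<inter> Ext (cball 0 1)"
      using T x by (simp add: norm_attain_def)
    show ?thesis
    proof (cases "T x \<in> Ext (cball 0 1)")
      case True
      then have "S x = 0"
        using S ME by (auto simp: admissible_def)
      then show ?thesis
        using nx by simp
    next
      case False
      then obtain f w where fw: "supp_functionals (T x) = {f}" "w \<noteq> 0" "f w = 0"
        "norm (T x + w) \<le> 1" "norm (T x - w) \<le> 1"
        using nonextreme_supp_functionals[OF dim nx(2)] by metis
      have f: "f (T x) = 1"
        using fw(1) mem_supp_functionals_iff by blast
      have "f (S x) = 0"
        using S ME False fw(1) by (auto simp: admissible_def)
      have nc: "noncollinear (T x) w"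
        using f fw by (intro noncollinear_functional[of f]) auto
      obtain a c where ac: "S x = a *\<^sub>R T x + c *\<^sub>R w"
        using noncollinear_coordinates[OF dim nc] by blast
      with \<open>f (S x) = 0\<close> f fw(3) have "a = 0"
        by (simp add: blinfun.add_right blinfun.scaleR_right)
      have "((\<lambda>e. \<bar>e * c\<bar>) \<longlongrightarrow> \<bar>0 * c\<bar>) (at_right 0)"
        by (intro tendsto_intros)
      then have "\<forall>\<^sub>F e in at_right 0. \<bar>e * c\<bar> < 1"
        by (auto intro: order_tendstoD(2))
      then show ?thesis
      proof eventually_elim
        case (elim e)
        have "norm (T x + (e * c) *\<^sub>R w) \<le> 1" "norm (T x + (- (e * c)) *\<^sub>R w) \<le> 1"
          using fw elim by (intro norm_le_1_between; simp)+
        then show ?case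
          by (simp add: ac \<open>a = 0\<close>)
      qed
    qed
  qed
qed

text \<open>One step size \<open>e\<close> serves all extreme points of the domain ball since they
  are finitely many, and operator norms are tested there. Conversely, an \<open>S\<close> that keeps
  \<open>T + S\<close> and \<open>T - S\<close> in the ball is itself admissible, without
  rescaling.\<close>

lemma extreme_contraction_iff_admissible:
  fixes T :: "'a::real_normed_vector \<Rightarrow>\<^sub>L 'b::real_normed_vector"
  assumes dims: "dim (UNIV :: 'a set) = 2" "dim (UNIV :: 'b set) = 2"
    and fin: "finite (Ext (cball (0::'a) 1))" and T: "norm T = 1"
  shows "extreme_contraction T \<longleftrightarrow> (\<forall>S. admissible T S \<longrightarrow> S = 0)"
proof (intro iffI allI impI)
  fix S
  assume ext: "extreme_contraction T" and S: "admissible T S"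
  have "\<forall>\<^sub>F e in at_right 0. \<forall>x \<in> Ext (cball 0 1).
      norm (T x + e *\<^sub>R S x) \<le> 1 \<and> norm (T x - e *\<^sub>R S x) \<le> 1"
  proof (rule eventually_ball_finite[OF fin], rule ballI)
    fix x :: 'a
    assume "x \<in> Ext (cball 0 1)"
    then show "\<forall>\<^sub>F e in at_right 0. norm (T x + e *\<^sub>R S x) \<le> 1 \<and> norm (T x - e *\<^sub>R S x) \<le> 1"
      by (rule admissible_perturbation[OF dims(2) T S])
  qed
  then have "\<forall>\<^sub>F e in at_right (0::real). e > 0 \<and> (\<forall>x \<in> Ext (cball 0 1).
      norm (T x + e *\<^sub>R S x) \<le> 1 \<and> norm (T x - e *\<^sub>R S x) \<le> 1)"
    using eventually_at_right_less[of "0::real"] by (rule eventually_conj[rotated])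
  then obtain e :: real where e: "e > 0" "\<And>x. x \<in> Ext (cball 0 1) \<Longrightarrow>
      norm (T x + e *\<^sub>R S x) \<le> 1 \<and> norm (T x - e *\<^sub>R S x) \<le> 1"
    using eventually_happens'[OF trivial_limit_at_right_real] by blast
  have "norm (T + e *\<^sub>R S) \<le> 1" "norm (T - e *\<^sub>R S) \<le> 1"
    using e by (auto intro!: plane_norm_le_1[OF dims(1)]
        simp: blinfun.add_left blinfun.diff_left blinfun.scaleR_left)
  with ext have "e *\<^sub>R S = 0"
    unfolding extreme_contraction_iff by blast
  with e show "S = 0"
    by simp
next
  assume adm: "\<forall>S. admissible T S \<longrightarrow> S = 0"
  show "extreme_contraction T"
    unfolding extreme_contraction_iff
  proof (intro conjI allI impI)
    fix S
    assume S: "norm (T + S) \<le> 1 \<and> norm (T - S) \<le> 1"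
    have le: "norm (T x + S x) \<le> 1 \<and> norm (T x - S x) \<le> 1" if "norm x = 1" for x
      using norm_blinfun[of "T + S" x] norm_blinfun[of "T - S" x] S that
      by (simp add: blinfun.add_left blinfun.diff_left)
    have "admissible T S"
      unfolding admissible_def
    proof
      fix x
      assume "x \<in> norm_attain T \<inter> Ext (cball 0 1)"
      then have "norm x = 1"
        by (simp add: norm_attain_def)
      note le = le[OF this]
      show "if T x \<in> Ext (cball 0 1) then S x = 0 else \<forall>f \<in> supp_functionals (T x). f (S x) = 0"
        using le supp_functionals_eq_0 by (auto simp: mem_Ext_cball_iff)
    qed
    with adm show "S = 0"
      by blast
  qed (use T in simp)
qed

section \<open>Edges as level sets of supporting functionals\<close>

lemma dim_eq_1_differences:
  fixes p q :: "'b::real_vector"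
  assumes "dim D = 1" "p - q \<in> D" "p \<noteq> q" "x \<in> D"
  obtains t where "x = t *\<^sub>R (p - q)"
proof -
  obtain B where B: "B \<subseteq> D" "independent B" "D \<subseteq> span B"
    using maximal_independent_subset by blast
  then have "card B = 1"
    using assms(1) basis_card_eq_dim by metis
  then obtain v where "B = {v}"
    by (auto simp: card_1_singleton_iff)
  with B have span: "D \<subseteq> range (\<lambda>k. k *\<^sub>R v)"
    by (simp add: span_singleton)
  then obtain k where k: "p - q = k *\<^sub>R v"
    using assms(2) by blast
  obtain l where "x = l *\<^sub>R v"
    using span assms(4) by blast
  moreover have "k \<noteq> 0"
    using k assms(3) by auto
  ultimately have "x = (l / k) *\<^sub>R (p - q)"
    by (simp add: k)
  then show thesis
    by (rule that)
qed

text \<open>The level set is a face because \<open>f\<close> is at most 1 on the ball, and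
  one-dimensional because it contains \<open>y + w\<close> and lies on the line through
  \<open>y\<close> in direction \<open>w\<close>. Conversely, an edge through \<open>y\<close> must
  absorb every segment of the ball that has \<open>y\<close> in its interior. The edges in (iii) are
  thus fixed by the functionals.\<close>

lemma edge_through_nonextreme_iff:
  fixes y :: "'b::real_normed_vector"
  assumes dim: "dim (UNIV :: 'b set) = 2"
    and y: "norm y = 1" "y \<notin> Ext (cball 0 1)" and f: "supp_functionals y = {f}"
  shows "F \<in> edges (cball 0 1) \<and> y \<in> F \<longleftrightarrow> F = {z \<in> cball 0 1. f z = 1}"
proof -
  obtain w where w: "w \<noteq> 0" "f w = 0" "norm (y + w) \<le> 1" "norm (y - w) \<le> 1"
    using nonextreme_supp_functionals[OF dim y] f by (metis singleton_inject)
  have mem: "f \<in> supp_functionals y"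
    using f by simp
  then have fy: "f y = 1"
    by (simp add: mem_supp_functionals_iff)
  have fle: "f z \<le> 1" if "norm z \<le> 1" for z
    using supp_functionals_le[OF mem, of z] that by simp
  have line: "\<exists>t. z = y + t *\<^sub>R w" if "f z = 1" for z
  proof -
    have "noncollinear y w"
      using fy w by (intro noncollinear_functional[of f]) auto
    then obtain a b where z: "z = a *\<^sub>R y + b *\<^sub>R w"
      using noncollinear_coordinates[OF dim] by blast
    moreover have "a = 1"
      using that z fy w by (simp add: blinfun.add_right blinfun.scaleR_right)
    ultimately show ?thesis
      by auto
  qed
  show ?thesis
  proof
    assume F: "F = {z \<in> cball 0 1. f z = 1}"
    have "F face_of cball 0 1"
      unfolding face_of_def
    proof (intro conjI ballI impI)
      show "convex F"
        unfolding F
        by (rule convexI)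
           (auto simp: blinfun.add_right blinfun.scaleR_right
             intro: convexD[OF convex_cball, of _ "0::'b" 1, simplified mem_cball_0])
      fix a b x
      assume ab: "a \<in> cball 0 1" "b \<in> cball 0 1" and x: "x \<in> F" "x \<in> open_segment a b"
      then obtain u where u: "0 < u" "u < 1" "x = (1 - u) *\<^sub>R a + u *\<^sub>R b"
        by (auto simp: in_segment)
      have 1: "(1 - u) * f a + u * f b = 1"
        using x(1) by (simp add: F u(3) blinfun.add_right blinfun.scaleR_right)
      have 2: "f a \<le> 1" "f b \<le> 1"
        using ab fle by auto
      have "(1 - u) * (1 - f a) + u * (1 - f b) = 0"
        using 1 by (simp add: algebra_simps)
      moreover have "0 \<le> (1 - u) * (1 - f a)" "0 \<le> u * (1 - f b)"
        using u 2 by auto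
      ultimately have "(1 - u) * (1 - f a) = 0" "u * (1 - f b) = 0"
        by linarith+
      then show "a \<in> F" "b \<in> F"
        using u ab by (auto simp: F)
    qed (auto simp: F)
    moreover have "dim {x - z | x z. x \<in> F \<and> z \<in> F} = 1"
    proof (rule dim_unique[of "{w}"])
      have "y + w \<in> F" "y \<in> F"
        using y w fy by (auto simp: F blinfun.add_right)
      moreover have "w = (y + w) - y"
        by simp
      ultimately show "{w} \<subseteq> {x - z | x z. x \<in> F \<and> z \<in> F}"
        by blast
      show "{x - z | x z. x \<in> F \<and> z \<in> F} \<subseteq> span {w}"
      proof clarify
        fix x z
        assume "x \<in> F" "z \<in> F"
        then have "f x = 1" "f z = 1"
          by (auto simp: F)
        then obtain s t where "x = y + s *\<^sub>R w" "z = y + t *\<^sub>R w"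
          using line by blast
        then have "x - z = (s - t) *\<^sub>R w"
          by (simp add: algebra_simps)
        then show "x - z \<in> span {w}"
          by (auto simp: span_singleton)
      qed
    qed (use w in \<open>auto simp: independent_insert\<close>)
    moreover have "y \<in> F"
      using y fy by (simp add: F)
    ultimately show "F \<in> edges (cball 0 1) \<and> y \<in> F"
      by (simp add: edges_def)
  next
    assume asm: "F \<in> edges (cball 0 1) \<and> y \<in> F"
    then have face: "F face_of cball 0 1" and D: "dim {x - z | x z. x \<in> F \<and> z \<in> F} = 1"
      and yF: "y \<in> F"
      by (auto simp: edges_def)
    \<comment> \<open>A face contains the ends of each segment of the ball around its point
      \<open>y\<close>. Here \<open>r\<close> is the ratio of the distances of the two ends from
      \<open>y\<close>, which puts the weight \<open>1 / (1 + r)\<close> on the far end.\<close>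
    have segF: "y + s *\<^sub>R w \<in> F"
      if "s \<noteq> 0" "r > 0" "norm (y + s *\<^sub>R w) \<le> 1" "norm (y - (r * s) *\<^sub>R w) \<le> 1" for r s
    proof -
      define u where "u = 1 / (1 + r)"
      have u: "1 - u = r * u"
        using that by (simp add: u_def field_simps)
      have "y \<in> open_segment (y + s *\<^sub>R w) (y - (r * s) *\<^sub>R w)"
        unfolding in_segment
      proof (intro conjI exI)
        show "y + s *\<^sub>R w \<noteq> y - (r * s) *\<^sub>R w"
        proof
          assume "y + s *\<^sub>R w = y - (r * s) *\<^sub>R w"
          then have "(s * (1 + r)) *\<^sub>R w = 0"
            by (simp add: algebra_simps)
          then show False
            using w(1) that by simp
        qed
        show "0 < u" "u < 1"
          using that by (auto simp: u_def)
        have "(1 - u) *\<^sub>R (y + s *\<^sub>R w) + u *\<^sub>R (y - (r * s) *\<^sub>R w)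
          = (r * u + u) *\<^sub>R y"
          unfolding u by (simp add: algebra_simps)
        also have "r * u + u = 1"
          using u by linarith
        finally show "y = (1 - u) *\<^sub>R (y + s *\<^sub>R w) + u *\<^sub>R (y - (r * s) *\<^sub>R w)"
          by simp
      qed
      with face yF that show ?thesis
        unfolding face_of_def by (meson mem_cball_0)
    qed
    have "y + w \<in> F"
      using segF[of 1 1] w by simp
    show "F = {z \<in> cball 0 1. f z = 1}"
    proof (intro subset_antisym subsetI)
      fix z
      assume z: "z \<in> F"
      then have "z \<in> cball 0 1"
        using face face_of_imp_subset by blast
      moreover have "(y + w) - y \<in> {x - z | x z. x \<in> F \<and> z \<in> F}"
        "z - y \<in> {x - z | x z. x \<in> F \<and> z \<in> F}"
        using \<open>y + w \<in> F\<close> yF z by blast+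
      then obtain t where "z - y = t *\<^sub>R ((y + w) - y)"
        using dim_eq_1_differences[OF D, of "y + w" y "z - y"] w(1) by auto
      then have "z = y + t *\<^sub>R w"
        by (simp add: algebra_simps)
      then have "f z = 1"
        using fy w by (simp add: blinfun.add_right blinfun.scaleR_right)
      ultimately show "z \<in> {z \<in> cball 0 1. f z = 1}"
        by simp
    next
      fix z
      assume "z \<in> {z \<in> cball 0 1. f z = 1}"
      then obtain t where t: "z = y + t *\<^sub>R w" "norm (y + t *\<^sub>R w) \<le> 1"
        using line by auto
      show "z \<in> F"
      proof (cases "t = 0")
        case False
        \<comment> \<open>With this ratio the opposite end is \<open>y - w\<close> or
          \<open>y + w\<close>, both known to lie in the ball.\<close>
        have "norm (y - ((1 / \<bar>t\<bar>) * t) *\<^sub>R w) \<le> 1"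
          using w y(1) by (cases t "0::real" rule: linorder_cases) auto
        with t False show ?thesis
          using segF[of t "1 / \<bar>t\<bar>"] by simp
      qed (use t yF in simp)
    qed
  qed
qed

lemma uminus_supp_functionals:
  "f \<in> supp_functionals y \<Longrightarrow> - f \<in> supp_functionals (- y)"
  by (simp add: mem_supp_functionals_iff blinfun.minus_left blinfun.minus_right)

text \<open>If the level sets agree, \<open>y\<close> lies in that of \<open>g\<close>, so
  \<open>g\<close> supports \<open>y\<close> and uniqueness applies. The negated level set of
  \<open>g\<close> is the level set of \<open>- g\<close>.\<close>

lemma opposite_edges_iff:
  fixes y :: "'b::real_normed_vector" and f g :: "'b \<Rightarrow>\<^sub>L real"
  assumes y: "norm y = 1" and f: "supp_functionals y = {f}" and g: "norm g = 1"
  shows "{z \<in> cball 0 1. f z = 1} = {z \<in> cball 0 1. g z = 1} \<longleftrightarrow> f = g"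
    and "{z \<in> cball 0 1. f z = 1} = uminus ` {z \<in> cball 0 1. g z = 1} \<longleftrightarrow> f = - g"
proof -
  have "f \<in> supp_functionals y"
    using f by simp
  then have yF: "y \<in> {z \<in> cball 0 1. f z = 1}"
    using y by (simp add: mem_supp_functionals_iff)
  show "{z \<in> cball 0 1. f z = 1} = {z \<in> cball 0 1. g z = 1} \<longleftrightarrow> f = g"
  proof
    assume "{z \<in> cball 0 1. f z = 1} = {z \<in> cball 0 1. g z = 1}"
    with yF have "y \<in> {z \<in> cball 0 1. g z = 1}"
      by blast
    with g have "g \<in> supp_functionals y"
      by (simp add: mem_supp_functionals_iff)
    with f show "f = g"
      by simp
  qed simp
  have *: "uminus ` {z \<in> cball 0 1. g z = 1} = {z \<in> cball 0 1. (- g) z = 1}"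
  proof (intro subset_antisym subsetI)
    fix z
    assume "z \<in> {z \<in> cball 0 1. (- g) z = 1}"
    then have "- z \<in> {z \<in> cball 0 1. g z = 1}"
      by (simp add: blinfun.minus_left blinfun.minus_right)
    then show "z \<in> uminus ` {z \<in> cball 0 1. g z = 1}"
      by (metis imageI minus_minus)
  qed (auto simp: blinfun.minus_left blinfun.minus_right)
  show "{z \<in> cball 0 1. f z = 1} = uminus ` {z \<in> cball 0 1. g z = 1} \<longleftrightarrow> f = - g"
    unfolding *
  proof
    assume "{z \<in> cball 0 1. f z = 1} = {z \<in> cball 0 1. (- g) z = 1}"
    with yF have "y \<in> {z \<in> cball 0 1. (- g) z = 1}"
      by blast
    with g have "- g \<in> supp_functionals y"
      by (simp add: mem_supp_functionals_iff)
    with f show "f = - g"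
      by simp
  qed simp
qed

lemma distinct_four_iff:
  fixes x1 x2 :: "'a::real_vector"
  assumes "- x1 \<noteq> x1" "- x2 \<noteq> x2"
  shows "distinct [x1, - x1, x2, - x2] \<longleftrightarrow> x1 \<noteq> x2 \<and> x1 \<noteq> - x2"
  unfolding distinct.simps list.set insert_iff empty_iff
  using assms by (metis minus_minus)

lemma distinct_six_iff:
  fixes x1 x2 x3 :: "'a::real_vector"
  assumes "- x1 \<noteq> x1" "- x2 \<noteq> x2" "- x3 \<noteq> x3"
  shows "distinct [x1, - x1, x2, - x2, x3, - x3] \<longleftrightarrow>
    x1 \<noteq> x2 \<and> x1 \<noteq> - x2 \<and> x1 \<noteq> x3 \<and> x1 \<noteq> - x3 \<and> x2 \<noteq> x3 \<and> x2 \<noteq> - x3"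
  unfolding distinct.simps list.set insert_iff empty_iff neg_equal_iff_equal
  using assms by (metis minus_minus)

section \<open>Norm-attaining extreme points of a fixed operator\<close>

locale polygonal_contraction =
  fixes T :: "'a::real_normed_vector \<Rightarrow>\<^sub>L 'b::real_normed_vector"
  assumes dimX: "dim (UNIV :: 'a set) = 2" and dimY: "dim (UNIV :: 'b set) = 2"
    and finX: "finite (Ext (cball (0::'a) 1))" and norm_T: "norm T = 1"
begin

abbreviation "ME \<equiv> norm_attain T \<inter> Ext (cball 0 1)"

abbreviation "EY \<equiv> Ext (cball (0::'b) 1)"

lemmas extreme_iff = extreme_contraction_iff_admissible[OF dimX dimY finX norm_T]

lemma finite_ME: "finite ME"
  using finX by simp

lemma norm_ME:
  assumes "x \<in> ME"
  shows "norm x = 1" "norm (T x) = 1"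
  using assms norm_T by (auto simp: norm_attain_def)

lemma uminus_ME_iff [simp]: "- x \<in> ME \<longleftrightarrow> x \<in> ME"
  by (auto simp: norm_attain_def blinfun.minus_right)

lemma uminus_neq_ME:
  assumes "x \<in> ME"
  shows "- x \<noteq> x"
proof
  assume "- x = x"
  then have "x + x = 0"
    by (simp add: neg_eq_iff_add_eq_0)
  then have "2 *\<^sub>R x = 0"
    by (simp add: scaleR_2)
  then show False
    using norm_ME(1)[OF assms] by simp
qed

lemma noncollinear_ME:
  assumes "x \<in> ME" "z \<in> ME" "x \<noteq> z" "x \<noteq> - z"
  shows "noncollinear x z"
  using assms norm_ME(1) by (intro noncollinear_unit) auto

lemma ME_coordinates:
  assumes "x \<in> ME" "u \<in> ME" "v \<in> ME" "u \<noteq> v" "u \<noteq> - v" "x \<noteq> u" "x \<noteq> - u" "x \<noteq> v" "x \<noteq> - v"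
  obtains a b where "x = a *\<^sub>R u + b *\<^sub>R v" "a \<noteq> 0" "b \<noteq> 0"
proof -
  obtain a b where x: "x = a *\<^sub>R u + b *\<^sub>R v"
    using noncollinear_coordinates[OF dimX noncollinear_ME[OF assms(2-5)]] by blast
  have "a \<noteq> 0"
    using x noncollinear_not_scaleR[OF noncollinear_ME[OF assms(1,3,8,9)], of b] by auto
  moreover have "b \<noteq> 0"
    using x noncollinear_not_scaleR[OF noncollinear_ME[OF assms(1,2,6,7)], of a] by auto
  ultimately show thesis
    using that x by blast
qed

lemma ME_supp_functionals:
  assumes "x \<in> ME" "T x \<notin> EY"
  obtains f where "supp_functionals (T x) = {f}" "norm f = 1" "f (T x) = 1"
proof -
  obtain f where f: "supp_functionals (T x) = {f}"
    using nonextreme_supp_functionals[OF dimY norm_ME(2)[OF assms(1)] assms(2)] by metis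
  then have "f \<in> supp_functionals (T x)"
    by simp
  then have "norm f = 1" "f (T x) = 1"
    by (simp_all add: mem_supp_functionals_iff)
  with f show thesis
    by (rule that)
qed

text \<open>An extreme image forces \<open>S x = 0\<close>, so the equation
  \<open>f (S x) = 0\<close> is available for every supporting functional, whatever the kind of the
  image.\<close>

lemma admissible_eq_0:
  fixes S :: "'a \<Rightarrow>\<^sub>L 'b"
  assumes "admissible T S" "x \<in> ME"
  shows "T x \<in> EY \<Longrightarrow> S x = 0" and "f \<in> supp_functionals (T x) \<Longrightarrow> f (S x) = 0"
proof -
  have *: "if T x \<in> EY then S x = 0 else \<forall>f \<in> supp_functionals (T x). f (S x) = 0"
    using assms unfolding admissible_def by (rule bspec)
  then show "T x \<in> EY \<Longrightarrow> S x = 0"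
    by simp
  show "f (S x) = 0" if "f \<in> supp_functionals (T x)"
    using * that by (cases "T x \<in> EY") (simp_all add: blinfun.zero_right)
qed

text \<open>The conditions are invariant under negation of \<open>x\<close>, so one representative
  of each antipodal pair suffices.\<close>

lemma admissibleI:
  fixes S :: "'a \<Rightarrow>\<^sub>L 'b"
  assumes A: "\<And>x. x \<in> ME \<Longrightarrow> x \<in> A \<or> - x \<in> A"
    and S: "\<And>x. x \<in> A \<Longrightarrow> x \<in> ME \<Longrightarrow>
      S x = 0 \<or> (T x \<notin> EY \<and> (\<forall>f \<in> supp_functionals (T x). f (S x) = 0))"
  shows "admissible T S"
  unfolding admissible_def
proof
  fix x
  assume x: "x \<in> ME"
  let ?P = "\<lambda>x. S x = 0 \<or> (T x \<notin> EY \<and> (\<forall>f \<in> supp_functionals (T x). f (S x) = 0))"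
  have "?P x"
  proof (cases "x \<in> A")
    case False
    then have "?P (- x)"
      using A x S by (metis uminus_ME_iff)
    then show ?thesis
      using uminus_supp_functionals[of _ "T x"]
      by (fastforce simp: blinfun.minus_right blinfun.minus_left)
  qed (use S x in blast)
  then show "if T x \<in> EY then S x = 0 else \<forall>f \<in> supp_functionals (T x). f (S x) = 0"
    by auto
qed

lemma card_ME_lines_le: "card {x \<in> ME. \<bar>f (T x)\<bar> = 1} \<le> 4" for f :: "'b \<Rightarrow>\<^sub>L real"
proof -
  have "card {x \<in> ME. \<bar>f (T x)\<bar> = 1} \<le> card {x \<in> Ext (cball 0 1). \<bar>(f o\<^sub>L T) x\<bar> = 1}"
    using finX by (intro card_mono) auto
  also have "\<dots> \<le> 4"
    by (rule card_Ext_lines_le[OF dimX])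
  finally show ?thesis .
qed

text \<open>At most four points are excluded by the two lines and at most two more by
  \<open>x\<close> and \<open>- x\<close>: six, against at least eight.\<close>

lemma ex_ME_off_lines:
  fixes f :: "'b \<Rightarrow>\<^sub>L real"
  assumes "8 \<le> card ME"
  obtains z where "z \<in> ME" "\<bar>f (T z)\<bar> \<noteq> 1" "z \<noteq> x" "z \<noteq> - x"
proof -
  let ?L = "{x \<in> ME. \<bar>f (T x)\<bar> = 1}"
  have "card (?L \<union> {x, - x}) \<le> card ?L + card {x, - x}"
    by (rule card_Un_le)
  also have "\<dots> \<le> 4 + 2"
    using card_ME_lines_le[of f] by (intro add_mono) (auto simp: card_insert_if)
  finally have le: "card (?L \<union> {x, - x}) \<le> 6"
    by simp
  have "\<not> ME \<subseteq> ?L \<union> {x, - x}"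
  proof
    assume "ME \<subseteq> ?L \<union> {x, - x}"
    moreover have "finite ?L"
      using finite_ME by (rule finite_subset[rotated]) blast
    ultimately have "card ME \<le> card (?L \<union> {x, - x})"
      by (intro card_mono) simp_all
    with le assms show False
      by linarith
  qed
  then show thesis
    using that by blast
qed

text \<open>\<open>g\<close> takes the value 1 at \<open>T z\<close>, which neither \<open>f\<close>
  nor \<open>- f\<close> does. This turns the count on lines into independence of
  functionals.\<close>

lemma off_lines_supp_functionals:
  fixes f g :: "'b \<Rightarrow>\<^sub>L real"
  assumes "\<bar>f (T z)\<bar> \<noteq> 1" "g \<in> supp_functionals (T z)"
  shows "g \<noteq> f" "g \<noteq> - f"
proof -
  have "g (T z) = 1"
    using assms(2) by (simp add: mem_supp_functionals_iff)
  then have "g (T z) \<noteq> f (T z)" "g (T z) \<noteq> (- f) (T z)"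
    using assms(1) by (auto simp: blinfun.minus_left)
  then show "g \<noteq> f" "g \<noteq> - f"
    by blast+
qed

lemma distinct_edges_iff:
  assumes x: "x \<in> ME" "T x \<notin> EY" "supp_functionals (T x) = {f}"
    and z: "z \<in> ME" "T z \<notin> EY" "supp_functionals (T z) = {g}"
  shows "(\<exists>F \<in> edges (cball 0 1). \<exists>G \<in> edges (cball 0 1).
      T x \<in> F \<and> T z \<in> G \<and> F \<noteq> G \<and> F \<noteq> uminus ` G) \<longleftrightarrow> f \<noteq> g \<and> f \<noteq> - g"
proof -
  have "g \<in> supp_functionals (T z)"
    using z by simp
  then have g: "norm g = 1"
    by (simp add: mem_supp_functionals_iff)
  define F0 where "F0 = {w \<in> cball 0 1. f w = 1}"
  define G0 where "G0 = {w \<in> cball 0 1. g w = 1}"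
  have F: "F \<in> edges (cball 0 1) \<and> T x \<in> F \<longleftrightarrow> F = F0" for F
    unfolding F0_def by (rule edge_through_nonextreme_iff[OF dimY norm_ME(2)[OF x(1)] x(2,3)])
  have G: "G \<in> edges (cball 0 1) \<and> T z \<in> G \<longleftrightarrow> G = G0" for G
    unfolding G0_def by (rule edge_through_nonextreme_iff[OF dimY norm_ME(2)[OF z(1)] z(2,3)])
  have "(\<exists>F \<in> edges (cball 0 1). \<exists>G \<in> edges (cball 0 1).
      T x \<in> F \<and> T z \<in> G \<and> F \<noteq> G \<and> F \<noteq> uminus ` G) \<longleftrightarrow> F0 \<noteq> G0 \<and> F0 \<noteq> uminus ` G0"
    (is "?L \<longleftrightarrow> ?R")
  proof
    assume ?L
    then obtain F G where "F \<in> edges (cball 0 1)" "T x \<in> F" "G \<in> edges (cball 0 1)" "T z \<in> G"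
      and FG: "F \<noteq> G" "F \<noteq> uminus ` G"
      by blast
    then have "F = F0" "G = G0"
      using F[of F] G[of G] by simp_all
    with FG show ?R
      by simp
  next
    assume ?R
    moreover have "F0 \<in> edges (cball 0 1)" "T x \<in> F0" "G0 \<in> edges (cball 0 1)" "T z \<in> G0"
      using F[of F0] G[of G0] by simp_all
    ultimately show ?L
      by blast
  qed
  then show ?thesis
    unfolding F0_def G0_def opposite_edges_iff[OF norm_ME(2)[OF x(1)] x(3) g] .
qed

lemma distinct_four_ME_iff:
  assumes "x1 \<in> ME" "x2 \<in> ME"
  shows "distinct [x1, - x1, x2, - x2] \<longleftrightarrow> x1 \<noteq> x2 \<and> x1 \<noteq> - x2"
  by (rule distinct_four_iff) (rule uminus_neq_ME[OF assms(1)], rule uminus_neq_ME[OF assms(2)])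

lemma distinct_six_ME_iff:
  assumes "x1 \<in> ME" "x2 \<in> ME" "x3 \<in> ME"
  shows "distinct [x1, - x1, x2, - x2, x3, - x3] \<longleftrightarrow>
    x1 \<noteq> x2 \<and> x1 \<noteq> - x2 \<and> x1 \<noteq> x3 \<and> x1 \<noteq> - x3 \<and> x2 \<noteq> x3 \<and> x2 \<noteq> - x3"
  by (rule distinct_six_iff)
    (rule uminus_neq_ME[OF assms(1)], rule uminus_neq_ME[OF assms(2)], rule uminus_neq_ME[OF assms(3)])

lemma card_ME_ge_8:
  assumes ME: "x1 \<in> ME" "x2 \<in> ME" "x3 \<in> ME" "x4 \<in> ME"
    and "distinct [x1, - x1, x2, - x2, x3, - x3]" "x4 \<notin> {x1, - x1, x2, - x2, x3, - x3}"
  shows "8 \<le> card ME"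
proof -
  have "- x4 \<notin> set [x1, - x1, x2, - x2, x3, - x3]"
    using assms(6) unfolding list.set insert_iff empty_iff by (metis minus_minus)
  then have "distinct [x4, - x4, x1, - x1, x2, - x2, x3, - x3]"
    using assms(5,6) uminus_neq_ME[OF ME(4)]
    by (simp del: distinct.simps(2) add: distinct.simps(2)[of x4] distinct.simps(2)[of "- x4"])
  then have "card (set [x4, - x4, x1, - x1, x2, - x2, x3, - x3])
      = length [x4, - x4, x1, - x1, x2, - x2, x3, - x3]"
    by (rule distinct_card)
  also have "\<dots> = 8"
    by simp
  finally have "card (set [x4, - x4, x1, - x1, x2, - x2, x3, - x3]) = 8" .
  moreover have "set [x4, - x4, x1, - x1, x2, - x2, x3, - x3] \<subseteq> ME"
    unfolding list.set insert_subset using ME uminus_ME_iff by blast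
  ultimately show ?thesis
    using card_mono[OF finite_ME, of "set [x4, - x4, x1, - x1, x2, - x2, x3, - x3]"] by linarith
qed

section \<open>Sufficiency of the conditions\<close>

lemma extreme_if_two_extreme_images:
  assumes "x1 \<in> ME" "x2 \<in> ME" "x1 \<noteq> x2" "x1 \<noteq> - x2" "T x1 \<in> EY" "T x2 \<in> EY"
  shows "extreme_contraction T"
  unfolding extreme_iff
proof (intro allI impI)
  fix S
  assume "admissible T S"
  then have "S x1 = 0" "S x2 = 0"
    using admissible_eq_0(1) assms by blast+
  then show "S = 0"
    by (rule plane_blinfun_eq_0[OF dimX noncollinear_ME[OF assms(1-4)]])
qed

text \<open>As \<open>S x1 = 0\<close>, the vector \<open>S x3\<close> is a nonzero multiple of
  \<open>S x2\<close>; hence \<open>f\<close> and \<open>g\<close> both vanish at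
  \<open>S x2\<close>, and being independent they force it to be 0.\<close>

lemma extreme_if_one_extreme_image:
  fixes f g :: "'b \<Rightarrow>\<^sub>L real"
  assumes ME: "x1 \<in> ME" "x2 \<in> ME" "x3 \<in> ME"
    and neq: "x2 \<noteq> x1" "x2 \<noteq> - x1" "x3 \<noteq> x1" "x3 \<noteq> - x1"
    and x1: "T x1 \<in> EY" and f: "f \<in> supp_functionals (T x2)" "g \<in> supp_functionals (T x3)"
      "f \<noteq> g" "f \<noteq> - g"
  shows "extreme_contraction T"
  unfolding extreme_iff
proof (intro allI impI)
  fix S
  assume S: "admissible T S"
  have S1: "S x1 = 0"
    using admissible_eq_0(1)[OF S ME(1) x1] .
  have nc: "noncollinear x2 x1"
    using noncollinear_ME ME neq by blast
  obtain a b where x3: "x3 = a *\<^sub>R x2 + b *\<^sub>R x1"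
    using noncollinear_coordinates[OF dimX nc] by blast
  have "a \<noteq> 0"
    using x3 noncollinear_not_scaleR[OF noncollinear_ME[OF ME(3,1) neq(3,4)], of b] by auto
  have "f (S x2) = 0" "g (S x3) = 0"
    using admissible_eq_0(2)[OF S] ME f by blast+
  then have "f (S x2) = 0" "g (S x2) = 0"
    using \<open>a \<noteq> 0\<close> by (auto simp: x3 S1 blinfun.add_right blinfun.scaleR_right)
  then have "S x2 = 0"
    using f by (intro common_kernel_trivial[OF dimY, of f g]) (auto simp: mem_supp_functionals_iff)
  with S1 show "S = 0"
    by (intro plane_blinfun_eq_0[OF dimX nc])
qed

lemma extreme_if_many_one_extreme_image:
  assumes card: "8 \<le> card ME" and x1: "x1 \<in> ME" "T x1 \<in> EY"
  shows "extreme_contraction T"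
proof (cases "\<exists>x2 \<in> ME. x2 \<noteq> x1 \<and> x2 \<noteq> - x1 \<and> T x2 \<in> EY")
  case True
  then show ?thesis
    using extreme_if_two_extreme_images x1 by blast
next
  case False
  \<comment> \<open>The functional 0 never has absolute value 1, so only \<open>x1\<close> and
    \<open>- x1\<close> are excluded here.\<close>
  obtain x2 where x2: "x2 \<in> ME" "x2 \<noteq> x1" "x2 \<noteq> - x1"
    using ex_ME_off_lines[OF card, of 0 x1] by metis
  with False obtain f where f: "supp_functionals (T x2) = {f}" "norm f = 1"
    using ME_supp_functionals by metis
  obtain x3 where x3: "x3 \<in> ME" "\<bar>f (T x3)\<bar> \<noteq> 1" "x3 \<noteq> x1" "x3 \<noteq> - x1"
    using ex_ME_off_lines[OF card, of f x1] by metis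
  with False obtain g where g: "supp_functionals (T x3) = {g}" "norm g = 1"
    using ME_supp_functionals by metis
  then have "g \<noteq> f" "g \<noteq> - f"
    using off_lines_supp_functionals[OF x3(2)] by blast+
  then show ?thesis
    using extreme_if_one_extreme_image[OF x1(1) x3(1) x2(1) x3(3,4) x2(2,3) x1(2), of g f] f g
    by simp
qed

lemma extreme_if_nondegenerate:
  fixes y1 y2 y3 y4 :: "'b \<Rightarrow>\<^sub>L real"
  assumes card: "8 \<le> card ME" and nonext: "\<And>x. x \<in> ME \<Longrightarrow> T x \<notin> EY"
    and ME: "x1 \<in> ME" "x2 \<in> ME" "x3 \<in> ME" "x4 \<in> ME" and dist: "distinct [x1, x2, x3, x4]"
    and y: "y1 \<in> supp_functionals (T x1)" "y2 \<in> supp_functionals (T x2)"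
      "y3 \<in> supp_functionals (T x3)" "y4 \<in> supp_functionals (T x4)"
    and x2: "x2 = a *\<^sub>R x1 + b *\<^sub>R x3" and x4: "x4 = c *\<^sub>R x1 + d *\<^sub>R x3"
    and y2: "y2 = \<alpha>1 *\<^sub>R y1 + \<alpha>2 *\<^sub>R y3" and y4: "y4 = \<beta>1 *\<^sub>R y1 + \<beta>2 *\<^sub>R y3"
    and det: "\<beta>1 * \<alpha>2 * a * d - \<beta>2 * \<alpha>1 * b * c \<noteq> 0"
  shows "extreme_contraction T"
  unfolding extreme_iff
proof (intro allI impI)
  fix S
  assume S: "admissible T S"
  \<comment> \<open>If \<open>x3 = - x1\<close>, the unit vector \<open>x2\<close> would be a
    multiple of \<open>x1\<close>, hence equal to \<open>x1\<close> or to \<open>x3\<close>, against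
    distinctness.\<close>
  have "x3 \<noteq> - x1"
  proof
    assume "x3 = - x1"
    then have *: "x2 = (a - b) *\<^sub>R x1"
      by (simp add: x2 algebra_simps)
    then have "\<bar>a - b\<bar> = 1"
      using norm_ME(1)[OF ME(1)] norm_ME(1)[OF ME(2)] by simp
    then have "a - b = 1 \<or> a - b = -1"
      by linarith
    then show False
      using * dist \<open>x3 = - x1\<close> by auto
  qed
  then have nc: "noncollinear x1 x3"
    using ME dist by (intro noncollinear_ME) auto
  have y_norm: "norm y1 = 1" "norm y3 = 1"
    using y by (simp_all add: mem_supp_functionals_iff)
  have y0: "y1 (S x1) = 0" "y2 (S x2) = 0" "y3 (S x3) = 0" "y4 (S x4) = 0"
    using admissible_eq_0(2)[OF S] ME y by blast+
  show "S = 0"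
  proof (cases "y1 \<noteq> y3 \<and> y1 \<noteq> - y3")
    case True
    \<comment> \<open>These are the unknowns left by the conditions at \<open>x1\<close> and
      \<open>x3\<close>. The conditions at \<open>x2\<close> and \<open>x4\<close> form a
      homogeneous system in them with the given determinant, and the two product identities below
      are Cramer's rule.\<close>
    define u where "u = y3 (S x1)"
    define v where "v = y1 (S x3)"
    have 1: "\<alpha>1 * b * v + \<alpha>2 * a * u = 0"
      using y0 by (simp add: x2 y2 u_def v_def blinfun.bilinear_simps algebra_simps)
    have 2: "\<beta>1 * d * v + \<beta>2 * c * u = 0"
      using y0 by (simp add: x4 y4 u_def v_def blinfun.bilinear_simps algebra_simps)
    have "(\<beta>1 * \<alpha>2 * a * d - \<beta>2 * \<alpha>1 * b * c) * u
        = \<beta>1 * d * (\<alpha>1 * b * v + \<alpha>2 * a * u) - \<alpha>1 * b * (\<beta>1 * d * v + \<beta>2 * c * u)"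
      by (simp add: algebra_simps)
    then have "u = 0"
      using det by (simp add: 1 2)
    have "(\<beta>1 * \<alpha>2 * a * d - \<beta>2 * \<alpha>1 * b * c) * v
        = \<alpha>2 * a * (\<beta>1 * d * v + \<beta>2 * c * u) - \<beta>2 * c * (\<alpha>1 * b * v + \<alpha>2 * a * u)"
      by (simp add: algebra_simps)
    then have "v = 0"
      using det by (simp add: 1 2)
    have "S x1 = 0" "S x3 = 0"
      using \<open>u = 0\<close> \<open>v = 0\<close> y0 True y_norm
      by (auto intro!: common_kernel_trivial[OF dimY, of y1 y3] simp: u_def v_def)
    then show ?thesis
      by (rule plane_blinfun_eq_0[OF dimX nc])
  next
    case False
    \<comment> \<open>Now the coordinates of \<open>y2\<close> and \<open>y4\<close> are not unique, so the determinant carries no information;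
      but all \<open>S z\<close> lie in the kernel of \<open>y1\<close>.\<close>
    then have "y1 (S x3) = 0"
      using y0(3) by (auto simp: blinfun.minus_left)
    have y1S: "y1 (S z) = 0" for z
    proof -
      obtain s t where "z = s *\<^sub>R x1 + t *\<^sub>R x3"
        using noncollinear_coordinates[OF dimX nc] by blast
      then show ?thesis
        using y0(1) \<open>y1 (S x3) = 0\<close> by (simp add: blinfun.bilinear_simps)
    qed
    \<comment> \<open>Off the lines of \<open>y1\<close> the functional at \<open>T z\<close> is
      independent of \<open>y1\<close>, and both vanish at \<open>S z\<close>. Two such points that
      are neither equal nor opposite form a basis.\<close>
    have Sz: "S z = 0" if z: "z \<in> ME" "\<bar>y1 (T z)\<bar> \<noteq> 1" for z
    proof -
      obtain g where g: "supp_functionals (T z) = {g}" "norm g = 1"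
        using ME_supp_functionals[OF z(1) nonext[OF z(1)]] by metis
      then have "g (S z) = 0" "g \<noteq> y1" "g \<noteq> - y1"
        using admissible_eq_0(2)[OF S z(1)] off_lines_supp_functionals[OF z(2)] by blast+
      then show ?thesis
        using g y_norm y1S by (intro common_kernel_trivial[OF dimY, of g y1]) auto
    qed
    obtain x5 where x5: "x5 \<in> ME" "\<bar>y1 (T x5)\<bar> \<noteq> 1"
      using ex_ME_off_lines[OF card] by metis
    obtain x6 where x6: "x6 \<in> ME" "\<bar>y1 (T x6)\<bar> \<noteq> 1" "x6 \<noteq> x5" "x6 \<noteq> - x5"
      using ex_ME_off_lines[OF card] by metis
    show ?thesis
      using Sz x5 x6 by (intro plane_blinfun_eq_0[OF dimX noncollinear_ME[of x6 x5]]) auto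
  qed
qed

section \<open>Necessity of the conditions\<close>

lemma extreme_imp_two:
  assumes ext: "extreme_contraction T"
  obtains x1 x2 where "x1 \<in> ME" "x2 \<in> ME" "x2 \<noteq> x1" "x2 \<noteq> - x1"
proof -
  \<comment> \<open>Otherwise an operator that vanishes at \<open>x\<close> and not at a
    complementary vector is admissible.\<close>
  have *: "\<not> ME \<subseteq> {x, - x}" if "x \<noteq> 0" for x
  proof
    assume sub: "ME \<subseteq> {x, - x}"
    obtain v where xv: "noncollinear x v"
      using ex_noncollinear[OF dimX \<open>x \<noteq> 0\<close>] by blast
    obtain p :: 'b where "p \<noteq> 0"
      using ex_nonzero[OF dimY] by blast
    obtain S :: "'a \<Rightarrow>\<^sub>L 'b" where S: "S x = 0" "S v = p"
      using plane_extension[OF dimX xv] by blast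
    have "admissible T S"
      using sub S by (intro admissibleI[of "{x}"]) auto
    then have "S = 0"
      using ext unfolding extreme_iff by blast
    with S \<open>p \<noteq> 0\<close> show False
      by simp
  qed
  \<comment> \<open>An arbitrary nonzero \<open>u\<close> first shows that \<open>ME\<close> is
    nonempty; the second use, at a point of \<open>ME\<close>, yields the second pair.\<close>
  obtain u :: 'a where "u \<noteq> 0"
    using ex_nonzero[OF dimX] by blast
  then obtain x1 where x1: "x1 \<in> ME"
    using *[of u] by blast
  then have "x1 \<noteq> 0"
    using norm_ME(1) by fastforce
  then show thesis
    using *[of x1] x1 that by blast
qed

text \<open>If \<open>T x1\<close> were not extreme, moving it along its edge while keeping the
  image of \<open>x2\<close> fixed would be admissible.\<close>

lemma extreme_two_imp:
  assumes ext: "extreme_contraction T" and ME: "x1 \<in> ME" "x2 \<in> ME" "x1 \<noteq> x2" "x1 \<noteq> - x2"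
    and sub: "ME \<subseteq> {x1, - x1, x2, - x2}"
  shows "T x1 \<in> EY"
proof (rule ccontr)
  assume nonext: "T x1 \<notin> EY"
  then obtain f where f: "supp_functionals (T x1) = {f}"
    using ME_supp_functionals ME by metis
  obtain w where w: "w \<noteq> 0" "f w = 0"
    using ex_kernel[OF dimY] by blast
  obtain S :: "'a \<Rightarrow>\<^sub>L 'b" where S: "S x1 = w" "S x2 = 0"
    using plane_extension[OF dimX noncollinear_ME[OF ME]] by blast
  have "admissible T S"
    using sub S w f nonext by (intro admissibleI[of "{x1, x2}"]) auto
  then have "S = 0"
    using ext unfolding extreme_iff by blast
  with S w show False
    by simp
qed

text \<open>Three scalar equations on a four-dimensional space have a nonzero solution. Two are
  built in by taking \<open>S x1\<close> and \<open>S x2\<close> in the kernels of \<open>f1\<close>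
  and \<open>f2\<close>; the third is one linear equation for the scalars \<open>s\<close> and
  \<open>t\<close>.\<close>

lemma extreme_three_imp_extreme_image:
  assumes ext: "extreme_contraction T" and ME: "x1 \<in> ME" "x2 \<in> ME" "x3 \<in> ME"
    and neq: "x1 \<noteq> x2" "x1 \<noteq> - x2"
    and sub: "ME \<subseteq> {x1, - x1, x2, - x2, x3, - x3}"
  shows "T x1 \<in> EY \<or> T x2 \<in> EY \<or> T x3 \<in> EY"
proof (rule ccontr)
  assume nonext: "\<not> ?thesis"
  obtain f1 where f1: "supp_functionals (T x1) = {f1}"
    using ME_supp_functionals ME nonext by metis
  obtain f2 where f2: "supp_functionals (T x2) = {f2}"
    using ME_supp_functionals ME nonext by metis
  obtain f3 where f3: "supp_functionals (T x3) = {f3}"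
    using ME_supp_functionals ME nonext by metis
  obtain w1 where w1: "w1 \<noteq> 0" "f1 w1 = 0"
    using ex_kernel[OF dimY] by blast
  obtain w2 where w2: "w2 \<noteq> 0" "f2 w2 = 0"
    using ex_kernel[OF dimY] by blast
  have nc: "noncollinear x1 x2"
    using noncollinear_ME[OF ME(1,2) neq] .
  obtain a b where x3: "x3 = a *\<^sub>R x1 + b *\<^sub>R x2"
    using noncollinear_coordinates[OF dimX nc] by blast
  have "\<exists>s t. (s \<noteq> 0 \<or> t \<noteq> 0) \<and> a * f3 w1 * s + b * f3 w2 * t = 0"
  proof (cases "b * f3 w2 = 0")
    case True
    then show ?thesis
      by (intro exI[of _ 0] exI[of _ 1]) simp
  next
    case False
    then show ?thesis
      by (intro exI[of _ "b * f3 w2"] exI[of _ "- (a * f3 w1)"]) simp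
  qed
  then obtain s t where st: "s \<noteq> 0 \<or> t \<noteq> 0" "a * f3 w1 * s + b * f3 w2 * t = 0"
    by blast
  obtain S :: "'a \<Rightarrow>\<^sub>L 'b" where S: "S x1 = s *\<^sub>R w1" "S x2 = t *\<^sub>R w2"
    using plane_extension[OF dimX nc] by blast
  have "f3 (S x3) = 0"
    using st by (simp add: x3 S blinfun.bilinear_simps algebra_simps)
  moreover have "f1 (S x1) = 0" "f2 (S x2) = 0"
    using S w1 w2 by (simp_all add: blinfun.scaleR_right)
  ultimately have "admissible T S"
    using sub f1 f2 f3 nonext by (intro admissibleI[of "{x1, x2, x3}"]) auto
  then have "S = 0"
    using ext unfolding extreme_iff by blast
  with S st w1 w2 show False
    by auto
qed

text \<open>If \<open>f\<close> and \<open>g\<close> agree up to sign, they share a kernel vector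
  \<open>w\<close>. Then \<open>S x1 = 0\<close> and \<open>S x2 = w\<close> make
  \<open>S x3\<close> a multiple of \<open>w\<close>, and all conditions hold.\<close>

lemma extreme_three_imp_functionals:
  fixes f g :: "'b \<Rightarrow>\<^sub>L real"
  assumes ext: "extreme_contraction T" and ME: "x1 \<in> ME" "x2 \<in> ME" "x3 \<in> ME"
    and neq: "x1 \<noteq> x2" "x1 \<noteq> - x2"
    and sub: "ME \<subseteq> {x1, - x1, x2, - x2, x3, - x3}"
    and nonext: "T x2 \<notin> EY" "T x3 \<notin> EY"
    and f: "supp_functionals (T x2) = {f}" and g: "supp_functionals (T x3) = {g}"
  shows "f \<noteq> g \<and> f \<noteq> - g"
proof (rule ccontr)
  assume dep: "\<not> ?thesis"
  obtain w where w: "w \<noteq> 0" "f w = 0"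
    using ex_kernel[OF dimY] by blast
  then have "g w = 0"
    using dep by (auto simp: blinfun.minus_left)
  have nc: "noncollinear x1 x2"
    using noncollinear_ME[OF ME(1,2) neq] .
  obtain a b where x3: "x3 = a *\<^sub>R x1 + b *\<^sub>R x2"
    using noncollinear_coordinates[OF dimX nc] by blast
  obtain S :: "'a \<Rightarrow>\<^sub>L 'b" where S: "S x1 = 0" "S x2 = w"
    using plane_extension[OF dimX nc] by blast
  have "g (S x3) = 0"
    using \<open>g w = 0\<close> by (simp add: x3 S blinfun.bilinear_simps)
  then have "admissible T S"
    using sub f g nonext S w by (intro admissibleI[of "{x1, x2, x3}"]) auto
  then have "S = 0"
    using ext unfolding extreme_iff by blast
  with S w show False
    by simp
qed

text \<open>A nonzero \<open>S\<close> is built that meets the conditions at \<open>x1\<close>,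
  \<open>x2\<close> and \<open>x3\<close>. Extremality then yields a point \<open>x4\<close> where
  the condition fails, and the value found there is the determinant up to sign.\<close>

lemma extreme_imp_nondegenerate:
  assumes ext: "extreme_contraction T" and card: "8 \<le> card ME"
    and nonext: "\<And>x. x \<in> ME \<Longrightarrow> T x \<notin> EY"
  obtains x1 x2 x3 x4 y1 y2 y3 y4 a b c d \<alpha>1 \<alpha>2 \<beta>1 \<beta>2
  where "x1 \<in> ME" "x2 \<in> ME" "x3 \<in> ME" "x4 \<in> ME" "distinct [x1, x2, x3, x4]"
    "supp_functionals (T x1) = {y1}" "supp_functionals (T x2) = {y2}"
    "supp_functionals (T x3) = {y3}" "supp_functionals (T x4) = {y4}"
    "x2 = a *\<^sub>R x1 + b *\<^sub>R x3" "x4 = c *\<^sub>R x1 + d *\<^sub>R x3"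
    "y2 = \<alpha>1 *\<^sub>R y1 + \<alpha>2 *\<^sub>R y3" "y4 = \<beta>1 *\<^sub>R y1 + \<beta>2 *\<^sub>R y3"
    "\<beta>1 * \<alpha>2 * a * d - \<beta>2 * \<alpha>1 * b * c \<noteq> 0"
proof -
  obtain x1 where x1: "x1 \<in> ME"
    using extreme_imp_two[OF ext] by blast
  obtain y1 where y1: "supp_functionals (T x1) = {y1}" "norm y1 = 1" "y1 (T x1) = 1"
    using ME_supp_functionals[OF x1 nonext[OF x1]] by metis
  obtain x3 where x3: "x3 \<in> ME" "\<bar>y1 (T x3)\<bar> \<noteq> 1"
    using ex_ME_off_lines[OF card] by metis
  obtain y3 where y3: "supp_functionals (T x3) = {y3}" "norm y3 = 1" "y3 (T x3) = 1"
    using ME_supp_functionals[OF x3(1) nonext[OF x3(1)]] by metis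
  have y13: "y1 \<noteq> y3" "y1 \<noteq> - y3"
    using off_lines_supp_functionals[OF x3(2), of y3] y3(1) by auto
  have x13: "x1 \<noteq> x3" "x1 \<noteq> - x3"
    using x3(2) y1(3) by (auto simp: blinfun.minus_right)
  have nc: "noncollinear x1 x3"
    using noncollinear_ME[OF x1 x3(1) x13] .
  have "\<not> ME \<subseteq> {x1, - x1, x3, - x3}"
  proof
    assume "ME \<subseteq> {x1, - x1, x3, - x3}"
    then have "card ME \<le> card {x1, - x1, x3, - x3}"
      by (intro card_mono) auto
    also have "\<dots> \<le> 4"
      by (simp add: card_insert_if)
    finally show False
      using card by simp
  qed
  then obtain x2 where x2: "x2 \<in> ME" "x2 \<noteq> x1" "x2 \<noteq> - x1" "x2 \<noteq> x3" "x2 \<noteq> - x3"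
    by blast
  obtain y2 where y2: "supp_functionals (T x2) = {y2}" "norm y2 = 1" "y2 (T x2) = 1"
    using ME_supp_functionals[OF x2(1) nonext[OF x2(1)]] by metis
  obtain a b where ab: "x2 = a *\<^sub>R x1 + b *\<^sub>R x3" "a \<noteq> 0" "b \<noteq> 0"
    using ME_coordinates[OF x2(1) x1 x3(1) x13 x2(2-)] by blast
  obtain u v where uv: "y1 u = 1" "y3 u = 0" "y1 v = 0" "y3 v = 1"
    and dual: "\<And>h. h = blinfun_apply h u *\<^sub>R y1 + blinfun_apply h v *\<^sub>R y3"
    using plane_dual_basis[OF dimY y1(2) y3(2) y13] by blast
  \<comment> \<open>Multiples of \<open>v\<close> and \<open>u\<close> solve the conditions at
    \<open>x1\<close> and \<open>x3\<close>. The coefficients are chosen so that the two terms of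
    \<open>y2 (S x2)\<close>, each the product of \<open>a\<close>, \<open>b\<close>,
    \<open>y2 u\<close> and \<open>y2 v\<close>, cancel.\<close>
  obtain S :: "'a \<Rightarrow>\<^sub>L 'b" where S: "S x1 = (b * y2 u) *\<^sub>R v" "S x3 = (- (a * y2 v)) *\<^sub>R u"
    using plane_extension[OF dimX nc] by blast
  \<comment> \<open>The choice of \<open>x2\<close> away from both pairs makes \<open>a\<close> and
    \<open>b\<close> nonzero, so \<open>S = 0\<close> would give \<open>y2 = 0\<close>.\<close>
  have "S \<noteq> 0"
  proof
    assume "S = 0"
    then have "y3 (S x1) = 0" "y1 (S x3) = 0"
      by simp_all
    then have "y2 u = 0" "y2 v = 0"
      using ab uv by (simp_all add: S blinfun.scaleR_right blinfun.minus_right)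
    then have "y2 = 0"
      using dual[of y2] by (metis add.right_neutral scaleR_zero_left)
    then show False
      using y2(2) by simp
  qed
  then have "\<not> admissible T S"
    using ext unfolding extreme_iff by blast
  then obtain x4 y4 where x4: "x4 \<in> ME" "y4 \<in> supp_functionals (T x4)" "y4 (S x4) \<noteq> 0"
    unfolding admissible_def using nonext by metis
  then have y4: "supp_functionals (T x4) = {y4}"
    using ME_supp_functionals[OF x4(1) nonext[OF x4(1)]] by (metis singletonD)
  obtain c d where cd: "x4 = c *\<^sub>R x1 + d *\<^sub>R x3"
    using noncollinear_coordinates[OF dimX nc] by blast
  have "y1 (S x1) = 0" "y3 (S x3) = 0"
    using uv by (simp_all add: S blinfun.scaleR_right blinfun.minus_right)
  moreover have "y2 (S x2) = 0"
    by (simp add: ab(1) S blinfun.bilinear_simps)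
  \<comment> \<open>The conditions hold at the first three points with their unique functionals, and
    the one at \<open>x4\<close> fails.\<close>
  ultimately have "x4 \<noteq> x1" "x4 \<noteq> x2" "x4 \<noteq> x3"
    using x4 y1(1) y2(1) y3(1) by auto
  then have "distinct [x1, x2, x3, x4]"
    using x2 x13 by auto
  \<comment> \<open>With \<alpha>1 = \<open>y2 u\<close>, \<alpha>2 = \<open>y2 v\<close>, \<beta>1
    = \<open>y4 u\<close> and \<beta>2 = \<open>y4 v\<close>, the determinant is the negative of
    \<open>y4 (S x4)\<close>.\<close>
  moreover have "y4 u * y2 v * a * d - y4 v * y2 u * b * c \<noteq> 0"
    using x4(3) by (simp add: cd S blinfun.bilinear_simps algebra_simps)
  ultimately show thesis
    using that[OF x1 x2(1) x3(1) x4(1) _ y1(1) y2(1) y3(1) y4 ab(1) cd dual[of y2] dual[of y4]]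
    by blast
qed

end

section \<open>Case distinction by the number of antipodal pairs\<close>

theorem theorem2p3:
  fixes T :: "'a::banach \<Rightarrow>\<^sub>L 'b::banach"
  assumes "polygonal TYPE('a)" and "polygonal TYPE('b)"
    and "dim (UNIV :: 'a set) = 2" and "dim (UNIV :: 'b set) = 2"
    and "norm T = 1"
  defines "ME \<equiv> norm_attain T \<inter> Ext (cball 0 1)"
    and "EY \<equiv> Ext (cball (0::'b) 1)"
  shows "extreme_contraction T \<longleftrightarrow>
    \<comment> \<open>(i)\<close>
    (\<exists>x1 x2. distinct [x1, - x1, x2, - x2] \<and> ME = {x1, - x1, x2, - x2}
       \<and> T x1 \<in> EY \<and> T x2 \<in> EY)
    \<or> \<comment> \<open>(ii)\<close>
    (\<exists>x1 x2 x3. distinct [x1, - x1, x2, - x2, x3, - x3]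
       \<and> ME = {x1, - x1, x2, - x2, x3, - x3}
       \<and> card {x \<in> {x1, x2, x3}. T x \<in> EY} \<ge> 2)
    \<or> \<comment> \<open>(iii)\<close>
    (\<exists>x1 x2 x3. distinct [x1, - x1, x2, - x2, x3, - x3]
       \<and> ME = {x1, - x1, x2, - x2, x3, - x3}
       \<and> T x1 \<in> EY \<and> T x2 \<notin> EY \<and> T x3 \<notin> EY
       \<and> (\<exists>F \<in> edges (cball 0 1). \<exists>G \<in> edges (cball 0 1).
            T x2 \<in> F \<and> T x3 \<in> G \<and> F \<noteq> G \<and> F \<noteq> uminus ` G))
    \<or> \<comment> \<open>(iv)\<close>
    (card ME \<ge> 8 \<and> (\<exists>x \<in> ME. T x \<in> EY))
    \<or> \<comment> \<open>(v)\<close>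
    (card ME \<ge> 8 \<and> (\<forall>x \<in> ME. T x \<notin> EY)
       \<and> (\<exists>x1 \<in> ME. \<exists>x2 \<in> ME. \<exists>x3 \<in> ME. \<exists>x4 \<in> ME. distinct [x1, x2, x3, x4]
       \<and> (\<exists>y1 \<in> Ext (supp_functionals (T x1)). \<exists>y2 \<in> Ext (supp_functionals (T x2)).
          \<exists>y3 \<in> Ext (supp_functionals (T x3)). \<exists>y4 \<in> Ext (supp_functionals (T x4)).
          \<exists>a b c d \<alpha>1 \<alpha>2 \<beta>1 \<beta>2 :: real.
            x2 = a *\<^sub>R x1 + b *\<^sub>R x3 \<and> x4 = c *\<^sub>R x1 + d *\<^sub>R x3
            \<and> y2 = \<alpha>1 *\<^sub>R y1 + \<alpha>2 *\<^sub>R y3 \<and> y4 = \<beta>1 *\<^sub>R y1 + \<beta>2 *\<^sub>R y3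
            \<and> \<beta>1 * \<alpha>2 * a * d - \<beta>2 * \<alpha>1 * b * c \<noteq> 0)))"
proof -
  interpret polygonal_contraction T
    using assms by unfold_locales (auto simp: polygonal_def)
  note [simp] = uminus_ME_iff[folded ME_def]
  note two = extreme_if_two_extreme_images[folded ME_def EY_def]
  note one = extreme_if_one_extreme_image[folded ME_def EY_def]
  note edges = distinct_edges_iff[folded ME_def EY_def]
  note supp = ME_supp_functionals[folded ME_def EY_def]
  note distinct4 = distinct_four_ME_iff[folded ME_def]
  note distinct6 = distinct_six_ME_iff[folded ME_def]
  show ?thesis (is "_ \<longleftrightarrow> ?i \<or> ?ii \<or> ?iii \<or> ?iv \<or> ?v")
  proof
    assume ext: "extreme_contraction T"
    obtain x1 x2 where x12: "x1 \<in> ME" "x2 \<in> ME" "x2 \<noteq> x1" "x2 \<noteq> - x1"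
      using extreme_imp_two[OF ext, folded ME_def] by blast
    then have neq12: "x1 \<noteq> x2" "x1 \<noteq> - x2"
      by auto
    show "?i \<or> ?ii \<or> ?iii \<or> ?iv \<or> ?v"
    \<comment> \<open>By symmetry \<open>ME\<close> consists of two pairs, of three pairs, or of at
      least four, that is, at least eight points.\<close>
    proof (cases "ME \<subseteq> {x1, - x1, x2, - x2}")
      case True
      then have sub: "ME \<subseteq> {x2, - x2, x1, - x1}"
        by blast
      have "T x1 \<in> EY"
        by (rule extreme_two_imp[OF ext, folded ME_def EY_def, OF x12(1,2) neq12 True])
      moreover have "T x2 \<in> EY"
        by (rule extreme_two_imp[OF ext, folded ME_def EY_def, OF x12(2,1,3,4) sub])
      moreover have "ME = {x1, - x1, x2, - x2}"
        using True x12 by auto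
      moreover have "distinct [x1, - x1, x2, - x2]"
        using distinct4 x12(1,2) neq12 by blast
      ultimately have ?i
        using \<open>T x1 \<in> EY\<close> by (intro exI[of _ x1] exI[of _ x2] conjI)
      then show ?thesis
        by (rule disjI1)
    next
      case False
      then obtain x3 where x3: "x3 \<in> ME" "x3 \<notin> {x1, - x1, x2, - x2}"
        by blast
      then have "x1 \<noteq> x3" "x1 \<noteq> - x3" "x2 \<noteq> x3" "x2 \<noteq> - x3"
        by auto
      then have dist: "distinct [x1, - x1, x2, - x2, x3, - x3]"
        using distinct6 x12(1,2) x3(1) neq12 by blast
      show ?thesis
      proof (cases "ME \<subseteq> {x1, - x1, x2, - x2, x3, - x3}")
        case True
        then have ME: "ME = {x1, - x1, x2, - x2, x3, - x3}"
          using x12 x3 by auto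
        \<comment> \<open>Stated for arbitrary labels, since the pairs are permuted below to put one
          with an extreme image first.\<close>
        have three: "?i \<or> ?ii \<or> ?iii \<or> ?iv \<or> ?v"
          if ME: "ME = {x, - x, y, - y, z, - z}" and dist: "distinct [x, - x, y, - y, z, - z]"
            and Tx: "T x \<in> EY" for x y z
        proof (cases "T y \<in> EY \<or> T z \<in> EY")
          case True
          have "2 \<le> card {w \<in> {x, y, z}. T w \<in> EY}"
          proof (cases "T y \<in> EY")
            case True
            then have "card {x, y} \<le> card {w \<in> {x, y, z}. T w \<in> EY}"
              using Tx by (intro card_mono) auto
            then show ?thesis
              using dist by simp
          next
            case False
            with True have "card {x, z} \<le> card {w \<in> {x, y, z}. T w \<in> EY}"
              using Tx by (intro card_mono) auto
            then show ?thesis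
              using dist by simp
          qed
          with ME dist have ?ii
            by (intro exI[of _ x] exI[of _ y] exI[of _ z] conjI)
          then show ?thesis
            by (intro disjI2[OF disjI1])
        next
          case False
          have mem: "x \<in> ME" "y \<in> ME" "z \<in> ME"
            using ME by auto
          obtain f where f: "supp_functionals (T y) = {f}"
            using supp[OF mem(2)] False by blast
          obtain g where g: "supp_functionals (T z) = {g}"
            using supp[OF mem(3)] False by blast
          have "f \<noteq> g \<and> f \<noteq> - g"
            using dist False ME by (intro extreme_three_imp_functionals[OF ext,
              folded ME_def EY_def, OF mem _ _ _ _ _ f g]) auto
          then have "\<exists>F \<in> edges (cball 0 1). \<exists>G \<in> edges (cball 0 1).
              T y \<in> F \<and> T z \<in> G \<and> F \<noteq> G \<and> F \<noteq> uminus ` G"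
            using edges[OF mem(2) _ f mem(3) _ g] False by blast
          moreover have "T y \<notin> EY" "T z \<notin> EY"
            using False by auto
          ultimately have ?iii
            using ME dist Tx by (intro exI[of _ x] exI[of _ y] exI[of _ z] conjI)
          then show ?thesis
            by (intro disjI2[OF disjI2[OF disjI1]])
        qed
        have "T x1 \<in> EY \<or> T x2 \<in> EY \<or> T x3 \<in> EY"
          by (rule extreme_three_imp_extreme_image[OF ext, folded ME_def EY_def,
                OF x12(1,2) x3(1) neq12 True])
        then show ?thesis
        proof (elim disjE)
          assume "T x1 \<in> EY"
          then show ?thesis
            by (rule three[OF ME dist])
        next
          assume Tx: "T x2 \<in> EY"
          have ME: "ME = {x2, - x2, x1, - x1, x3, - x3}"
            using ME by blast
          have dist: "distinct [x2, - x2, x1, - x1, x3, - x3]"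
            using dist by auto
          show ?thesis
            by (rule three[OF ME dist Tx])
        next
          assume Tx: "T x3 \<in> EY"
          have ME: "ME = {x3, - x3, x1, - x1, x2, - x2}"
            using ME by blast
          have dist: "distinct [x3, - x3, x1, - x1, x2, - x2]"
            using dist by auto
          show ?thesis
            by (rule three[OF ME dist Tx])
        qed
      next
        case False
        then obtain x4 where "x4 \<in> ME" "x4 \<notin> {x1, - x1, x2, - x2, x3, - x3}"
          by blast
        then have card: "8 \<le> card ME"
          using card_ME_ge_8[folded ME_def] x12(1,2) x3(1) dist by blast
        show ?thesis
        proof (cases "\<exists>x \<in> ME. T x \<in> EY")
          case True
          with card have ?iv
            by (rule conjI)
          then show ?thesis
            by (intro disjI2[OF disjI2[OF disjI2[OF disjI1]]])
        next
          case False
          then have nonext: "\<And>x. x \<in> ME \<Longrightarrow> T x \<notin> EY"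
            by blast
          obtain x1 x2 x3 x4 y1 y2 y3 y4 a b c d \<alpha>1 \<alpha>2 \<beta>1 \<beta>2
            where v: "x1 \<in> ME" "x2 \<in> ME" "x3 \<in> ME" "x4 \<in> ME" "distinct [x1, x2, x3, x4]"
              and y: "supp_functionals (T x1) = {y1}" "supp_functionals (T x2) = {y2}"
                "supp_functionals (T x3) = {y3}" "supp_functionals (T x4) = {y4}"
              and eqs: "x2 = a *\<^sub>R x1 + b *\<^sub>R x3" "x4 = c *\<^sub>R x1 + d *\<^sub>R x3"
                "y2 = \<alpha>1 *\<^sub>R y1 + \<alpha>2 *\<^sub>R y3" "y4 = \<beta>1 *\<^sub>R y1 + \<beta>2 *\<^sub>R y3"
                "\<beta>1 * \<alpha>2 * a * d - \<beta>2 * \<alpha>1 * b * c \<noteq> 0"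
            by (rule extreme_imp_nondegenerate[OF ext, folded ME_def EY_def, OF card nonext])
          \<comment> \<open>All images are non-extreme, so each set of supporting functionals is a
            singleton, whose element is extreme in it.\<close>
          have Ext_y: "y1 \<in> Ext (supp_functionals (T x1))" "y2 \<in> Ext (supp_functionals (T x2))"
            "y3 \<in> Ext (supp_functionals (T x3))" "y4 \<in> Ext (supp_functionals (T x4))"
            by (simp_all add: y Ext_singleton)
          have ?v
          proof (rule conjI[OF card], rule conjI)
            show "\<forall>x \<in> ME. T x \<notin> EY"
              using nonext by (rule ballI)
          qed (rule bexI[of _ x1], rule bexI[of _ x2], rule bexI[of _ x3], rule bexI[of _ x4],
              rule conjI, rule v(5), rule bexI[of _ y1], rule bexI[of _ y2], rule bexI[of _ y3],
              rule bexI[of _ y4], rule exI[of _ a], rule exI[of _ b], rule exI[of _ c],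
              rule exI[of _ d], rule exI[of _ \<alpha>1], rule exI[of _ \<alpha>2], rule exI[of _ \<beta>1],
              rule exI[of _ \<beta>2], (intro conjI eqs), (rule Ext_y v)+)
          then show ?thesis
            by (intro disjI2[OF disjI2[OF disjI2[OF disjI2]]])
        qed
      qed
    qed
  next
    assume "?i \<or> ?ii \<or> ?iii \<or> ?iv \<or> ?v"
    then show "extreme_contraction T"
    proof (elim disjE)
      assume ?i
      then obtain x1 x2 where x: "distinct [x1, - x1, x2, - x2]" "ME = {x1, - x1, x2, - x2}"
        "T x1 \<in> EY" "T x2 \<in> EY"
        by (elim exE conjE) (rule that)
      then show ?thesis
        by (intro two[of x1 x2]) auto
    next
      assume ?ii
      then obtain x1 x2 x3 where dist: "distinct [x1, - x1, x2, - x2, x3, - x3]"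
        and ME: "ME = {x1, - x1, x2, - x2, x3, - x3}"
        and card: "2 \<le> card {x \<in> {x1, x2, x3}. T x \<in> EY}"
        by (elim exE conjE) (rule that)
      obtain B where "B \<subseteq> {x \<in> {x1, x2, x3}. T x \<in> EY}" "card B = 2"
        using card by (meson obtain_subset_with_card_n)
      then obtain x z where "{x, z} \<subseteq> {x \<in> {x1, x2, x3}. T x \<in> EY}" "x \<noteq> z"
        by (auto simp: card_2_iff)
      \<comment> \<open>\<open>x\<close> and \<open>z\<close> come from different antipodal pairs,
        so they are not opposite either.\<close>
      moreover from this have "x \<noteq> - z"
        using dist by auto
      ultimately show ?thesis
        by (intro two[of x z]) (auto simp: ME)
    next
      assume ?iii
      then obtain x1 x2 x3 where dist: "distinct [x1, - x1, x2, - x2, x3, - x3]"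
        and ME: "ME = {x1, - x1, x2, - x2, x3, - x3}"
        and T: "T x1 \<in> EY" "T x2 \<notin> EY" "T x3 \<notin> EY"
        and FG: "\<exists>F \<in> edges (cball 0 1). \<exists>G \<in> edges (cball 0 1).
          T x2 \<in> F \<and> T x3 \<in> G \<and> F \<noteq> G \<and> F \<noteq> uminus ` G"
        by (elim exE conjE) (rule that)
      have mem: "x1 \<in> ME" "x2 \<in> ME" "x3 \<in> ME"
        using ME by auto
      obtain f where f: "supp_functionals (T x2) = {f}"
        using supp[OF mem(2) T(2)] by blast
      obtain g where g: "supp_functionals (T x3) = {g}"
        using supp[OF mem(3) T(3)] by blast
      have "f \<noteq> g" "f \<noteq> - g"
        using edges[OF mem(2) T(2) f mem(3) T(3) g] FG by blast+
      then show ?thesis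
        using dist mem T f g by (intro one[of x1 x2 x3 f g]) auto
    next
      assume ?iv
      then show ?thesis
        using extreme_if_many_one_extreme_image[folded ME_def EY_def] by blast
    next
      assume v: ?v
      then obtain x1 x2 x3 x4 y1 y2 y3 y4 and a b c d \<alpha>1 \<alpha>2 \<beta>1 \<beta>2 :: real
        where x: "x1 \<in> ME" "x2 \<in> ME" "x3 \<in> ME" "x4 \<in> ME" "distinct [x1, x2, x3, x4]"
          and y: "y1 \<in> Ext (supp_functionals (T x1))" "y2 \<in> Ext (supp_functionals (T x2))"
            "y3 \<in> Ext (supp_functionals (T x3))" "y4 \<in> Ext (supp_functionals (T x4))"
          and eqs: "x2 = a *\<^sub>R x1 + b *\<^sub>R x3" "x4 = c *\<^sub>R x1 + d *\<^sub>R x3"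
            "y2 = \<alpha>1 *\<^sub>R y1 + \<alpha>2 *\<^sub>R y3" "y4 = \<beta>1 *\<^sub>R y1 + \<beta>2 *\<^sub>R y3"
            "\<beta>1 * \<alpha>2 * a * d - \<beta>2 * \<alpha>1 * b * c \<noteq> 0"
        by (elim exE bexE conjE) (rule that)
      note card = conjunct1[OF v] and nonext = bspec[OF conjunct1[OF conjunct2[OF v]]]
      have "y1 \<in> supp_functionals (T x1)" "y2 \<in> supp_functionals (T x2)"
        "y3 \<in> supp_functionals (T x3)" "y4 \<in> supp_functionals (T x4)"
        using y Ext_subset by blast+
      from extreme_if_nondegenerate[folded ME_def EY_def, OF card nonext x this eqs]
      show ?thesis .
    qed
  qed
qed

end
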